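(* Assume that there are constants $0<c_1\le c_2$ such that $$c_1\,k_n(x)\le \widetilde k_n(x)\le c_2\,k_n(x),\qquad x\in D,$$ and let $c=\frac{c_2}{c_1}\ge 1$. Let $\varepsilon\in(0,1)$. Then, under the sampling budget condition $$m\ge c\,\gamma\,n\,\ln(2n/\varepsilon),$$ one has ${\Pr}_x\left(\|G-I\|_2\ge \frac12\right)\le\varepsilon$. In addition, for every $u\in L^2(D,\mu)$, one has the convergence bound $$\mathbb E_x\left(\|u-\widetilde u_n\|^2\,\chi_{\{\|G-I\|_2\le \frac12\}}\right)\le (1+\eta(m))\,e_n(u)^2,$$ and, if $\|u\|_{L^\infty(D)}\le\tau$, $$\mathbb E_x\left(\|u-\widetilde u_n^T\|^2\right)\le (1+\eta(m))\,e_n(u)^2+4\,\varepsilon\,\tau^2,$$ where $\eta(m)=4\,c\,\frac nm\le \frac{4}{\gamma\ln(2n/\varepsilon)}$.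
   Context: Setting. $D\subset\mathbb R^d$, $\mu$ is a probability measure on $D$, $\|\cdot\|$ is the norm of $L^2(D,\mu)$, and $V_n\subset L^2(D,\mu)$ is an $n$-dimensional linear space of real-valued functions defined pointwise on $D$. Let $(L_1,\dots,L_n)$ be an $L^2(D,\mu)$-orthonormal basis of $V_n$ and $k_n(x)=\sum_{j=1}^n|L_j(x)|^2$ (the inverse Christoffel function, independent of the choice of basis). Put $e_n(u)=\min_{v\in V_n}\|u-v\|$ and $\gamma=\left(\frac32\ln\frac32-\frac12\right)^{-1}$. $\|\cdot\|_2$ is the spectral norm of matrices and $\chi_A$ the indicator of an event $A$. Offline stage. Points $z^1,\dots,z^M$ are drawn independently according to $\mu$, and $(\widetilde L_1,\dots,\widetilde L_n)$ is an orthonormal basis of $V_n$ for the inner product $\langle u,v\rangle_M=\frac1M\sum_{i=1}^M u(z^i)v(z^i)$ (the points being such that this is an inner product on $V_n$). Define $\widetilde k_n=\sum_{j=1}^n|\widetilde L_j|^2$ and the probability measure $d\widetilde\sigma=\alpha\,\frac{\widetilde k_n}{n}\,d\mu$, where $\alpha$ is the normalization factor such that $\alpha\int_D\widetilde k_n\,d\mu=n$. Online stage. Given the offline points (so $\widetilde k_n$ is fixed), $x^1,\dots,x^m$ are drawn independently according to $\widetilde\sigma$; $\Pr_x,\mathbb E_x$ denote probability and expectation with respect to this draw only, given the $z^i$. Let $\widetilde w=\frac{n}{\alpha\widetilde k_n}$ (defined where $\widetilde k_n>0$), $\langle u,v\rangle_m=\frac1m\sum_{i=1}^m\widetilde w(x^i)u(x^i)v(x^i)$,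 and $G=(\langle L_j,L_k\rangle_m)_{j,k=1,\dots,n}$. The estimator $\widetilde u_n\in V_n$ is a solution of the weighted least-squares problem $\min_{v\in V_n}\sum_{i=1}^m\widetilde w(x^i)|u(x^i)-v(x^i)|^2$ (unique when $G$ is nonsingular). For $\tau>0$ the truncated estimator is $\widetilde u_n^T=T_\tau\circ\widetilde u_n$, with $T_\tau(y)=\min\{\tau,|y|\}\,\mathrm{sgn}(y)$. *)

theory Defs
  imports "HOL-Probability.Probability" "HOL-Library.Function_Algebras"
begin

text \<open>Functions on a set \<open>D\<close> are represented by total functions of which only the values
  on \<open>D\<close> matter; a linear space of functions on \<open>D\<close> is represented, for instance, by the
  extensions by zero of its members.\<close>

definition fscale :: "real \<Rightarrow> ('a \<Rightarrow> real) \<Rightarrow> 'a \<Rightarrow> real" where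
  "fscale r f = (\<lambda>x. r * f x)"

global_interpretation fun_vs: vector_space "fscale :: real \<Rightarrow> ('a \<Rightarrow> real) \<Rightarrow> 'a \<Rightarrow> real"
  by unfold_locales (auto simp: fscale_def fun_eq_iff algebra_simps)

text \<open>Elements of \<open>L\<^sup>2\<close> are represented by functions, not by equivalence classes: the
  least-squares problem below uses point values.\<close>

definition L2 :: "'a measure \<Rightarrow> ('a \<Rightarrow> real) set" where
  "L2 \<mu> = {f \<in> borel_measurable \<mu>. integrable \<mu> (\<lambda>x. (f x)\<^sup>2)}"

definition L2_inner :: "'a measure \<Rightarrow> ('a \<Rightarrow> real) \<Rightarrow> ('a \<Rightarrow> real) \<Rightarrow> real" where
  "L2_inner \<mu> f g = (\<integral>x. f x * g x \<partial>\<mu>)"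

definition L2_norm :: "'a measure \<Rightarrow> ('a \<Rightarrow> real) \<Rightarrow> real" where
  "L2_norm \<mu> f = sqrt (L2_inner \<mu> f f)"

text \<open>For a finite-dimensional \<open>V \<subseteq> L2 \<mu>\<close> the infimum is a minimum.\<close>

definition best_error :: "'a measure \<Rightarrow> ('a \<Rightarrow> real) set \<Rightarrow> ('a \<Rightarrow> real) \<Rightarrow> real" where
  "best_error \<mu> V u = (INF v\<in>V. L2_norm \<mu> (\<lambda>x. u x - v x))"

definition empirical_inner ::
    "nat \<Rightarrow> (nat \<Rightarrow> 'a) \<Rightarrow> ('a \<Rightarrow> real) \<Rightarrow> ('a \<Rightarrow> real) \<Rightarrow> real" where
  "empirical_inner M z u v = (\<Sum>i=1..M. u (z i) * v (z i)) / real M"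

definition weighted_inner ::
    "('a \<Rightarrow> real) \<Rightarrow> nat \<Rightarrow> (nat \<Rightarrow> 'a) \<Rightarrow> ('a \<Rightarrow> real) \<Rightarrow> ('a \<Rightarrow> real) \<Rightarrow> real" where
  "weighted_inner w m x u v = (\<Sum>i=1..m. w (x i) * u (x i) * v (x i)) / real m"

definition orthonormal_basis ::
    "(('a \<Rightarrow> real) \<Rightarrow> ('a \<Rightarrow> real) \<Rightarrow> real) \<Rightarrow> ('a \<Rightarrow> real) set \<Rightarrow> ('n::finite \<Rightarrow> 'a \<Rightarrow> real) \<Rightarrow> bool"
  where
  "orthonormal_basis ip V B \<longleftrightarrow>
     fun_vs.span (range B) = V \<and> (\<forall>j k. ip (B j) (B k) = (if j = k then 1 else 0))"

definition inv_christoffel :: "('n::finite \<Rightarrow> 'a \<Rightarrow> real) \<Rightarrow> 'a \<Rightarrow> real" where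
  "inv_christoffel B x = (\<Sum>j\<in>UNIV. \<bar>B j x\<bar>\<^sup>2)"

text \<open>The constant \<open>\<alpha>\<close> with \<open>\<alpha> * (\<integral>x. k x \<partial>\<mu>) = n\<close>.\<close>

definition norm_factor :: "'a measure \<Rightarrow> nat \<Rightarrow> ('a \<Rightarrow> real) \<Rightarrow> real" where
  "norm_factor \<mu> n k = real n / (\<integral>x. k x \<partial>\<mu>)"

definition sampling_measure :: "'a measure \<Rightarrow> nat \<Rightarrow> ('a \<Rightarrow> real) \<Rightarrow> 'a measure" where
  "sampling_measure \<mu> n k = density \<mu> (\<lambda>x. ennreal (norm_factor \<mu> n k * (k x / real n)))"

text \<open>Where \<open>k\<close> vanishes the weight is 0 by the convention \<open>a / 0 = 0\<close>; such points form a null set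
  of the sampling measure.\<close>

definition weight :: "'a measure \<Rightarrow> nat \<Rightarrow> ('a \<Rightarrow> real) \<Rightarrow> 'a \<Rightarrow> real" where
  "weight \<mu> n k x = real n / (norm_factor \<mu> n k * k x)"

definition gram :: "('a \<Rightarrow> real) \<Rightarrow> nat \<Rightarrow> (nat \<Rightarrow> 'a) \<Rightarrow> ('n::finite \<Rightarrow> 'a \<Rightarrow> real) \<Rightarrow> real^'n^'n" where
  "gram w m x L = (\<chi> j k. weighted_inner w m x (L j) (L k))"

definition spectral_norm :: "real^'n^'n \<Rightarrow> real" where
  "spectral_norm A = onorm ((*v) A)"

definition is_wls_solution ::
    "('a \<Rightarrow> real) set \<Rightarrow> ('a \<Rightarrow> real) \<Rightarrow> nat \<Rightarrow> (nat \<Rightarrow> 'a) \<Rightarrow> ('a \<Rightarrow> real) \<Rightarrow> ('a \<Rightarrow> real) \<Rightarrow> bool" where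
  "is_wls_solution V w m x u =
     is_arg_min (\<lambda>v. \<Sum>i=1..m. w (x i) * \<bar>u (x i) - v (x i)\<bar>\<^sup>2) (\<lambda>v. v \<in> V)"

definition truncate :: "real \<Rightarrow> real \<Rightarrow> real" where
  "truncate \<tau> y = min \<tau> \<bar>y\<bar> * sgn y"

end

theory Submission
  imports Defs
begin

text \<open>
  The proof has two independent parts: a concentration inequality for the Gram matrix and a
  second-moment computation for least squares.

  \<^emph>\<open>Concentration.\<close> With \<open>a(y) = sqrt (w y) (L\<^sub>1 y, \<dots>, L\<^sub>n y)\<close> the Gram matrix is the average of the
  rank-one matrices \<open>a(x\<^sub>i) a(x\<^sub>i)\<^sup>T\<close>. The weight is the reciprocal of the sampling density, so
  each of them has mean \<open>I\<close>, and the comparison of \<open>k\<^sub>n\<close> with its perturbed version gives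
  \<open>|a(y)|\<^sup>2 \<le> R = c n\<close>. What is needed is the matrix Chernoff bound with its sharp rate
  \<open>(3/2) ln (3/2) - 1/2 = 1/\<gamma>\<close> and with the factor \<open>2 n\<close>. It is usually derived from the Golden--Thompson
  inequality or from Lieb's concavity theorem, but for rank-one summands an elementary argument works.
  For a positive semidefinite \<open>C\<close> the moments \<open>c\<^sub>p = \<langle>a, C\<^sup>p a\<rangle>\<close> are log-convex, hence
  \<open>c\<^sub>i c\<^sub>j \<le> |a|\<^sup>2 c\<^sub>i\<^sub>+\<^sub>j\<close>. Expanding powers of \<open>C + a a\<^sup>T\<close> produces products of such moments, and
  merging these products shows that along \<open>a\<close> the perturbation \<open>a a\<^sup>T\<close> increases every power by no more
  than the scalar shift \<open>r I\<close> does, when \<open>|a|\<^sup>2 \<le> r\<close> (\<open>mixed_moment_le\<close>). Summing the exponential series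
  yields \<open>tr exp (C + a a\<^sup>T) \<le> tr exp C + (e\<^sup>r - 1)/r \<langle>a, exp C a\<rangle>\<close> (\<open>trace_mexp_rank_one_le\<close>).
  The right-hand side is linear in \<open>a a\<^sup>T\<close>, so integrating out one sample multiplies
  \<open>tr exp\<close> by at most a constant, and Markov's inequality gives the upper tail. For the lower tail, the
  same comparison bounds the decrease of \<open>tr exp\<close> from below when \<open>a a\<^sup>T\<close> is subtracted
  (\<open>trace_mexp_rank_one_subdivided\<close>).
  The two tails combine to \<open>empirical_deviation\<close>.

  \<^emph>\<open>Least squares.\<close> Let \<open>g = u - P u\<close> be the residual of the orthogonal projection. By the normal
  equations the coefficient vector \<open>d\<close> of the estimator minus \<open>P u\<close> satisfies \<open>G d = b\<close> with
  \<open>b\<^sub>j = \<langle>g, L\<^sub>j\<rangle>\<^sub>m\<close>. On the event \<open>\<parallel>G - I\<parallel> \<le> 1/2\<close> this gives \<open>|d| \<le> 2 |b|\<close>. The vector \<open>b\<close>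
  is an average of \<open>m\<close> independent centred vectors, since \<open>g\<close> is orthogonal to \<open>V\<close>, so its second moment is
  at most \<open>(c n / m) \<parallel>g\<parallel>\<^sup>2\<close>; Pythagoras finishes the proof of \<open>wls_error_bound\<close>. For the truncated estimator, truncation
  does not increase the error pointwise, and off the event, which has probability at most \<open>\<epsilon>\<close>, the squared
  error is at most \<open>4 \<tau>\<^sup>2\<close>.
\<close>

section \<open>Positive semidefinite matrices and their moments\<close>

definition psd :: "real^'n^'n \<Rightarrow> bool" where
  "psd A \<longleftrightarrow> (\<forall>x y. x \<bullet> (A *v y) = (A *v x) \<bullet> y) \<and> (\<forall>x. 0 \<le> x \<bullet> (A *v x))"

lemma psd_self_adjoint: "psd A \<Longrightarrow> x \<bullet> (A *v y) = (A *v x) \<bullet> y"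
  by (simp add: psd_def)

lemma psd_nonneg: "psd A \<Longrightarrow> 0 \<le> x \<bullet> (A *v x)"
  unfolding psd_def by blast

lemma psd_add: "psd A \<Longrightarrow> psd B \<Longrightarrow> psd (A + B)"
  unfolding psd_def matrix_vector_mult_add_rdistrib inner_add_left inner_add_right
  by (metis add_nonneg_nonneg)

lemma psd_cauchy_schwarz:
  assumes "psd A"
  shows "(x \<bullet> (A *v y))\<^sup>2 \<le> (x \<bullet> (A *v x)) * (y \<bullet> (A *v y))"
proof -
  have sym: "y \<bullet> (A *v x) = x \<bullet> (A *v y)"
    using psd_self_adjoint[OF assms, of y x] by (simp add: inner_commute)
  have quad: "0 \<le> (y \<bullet> (A *v y)) * t\<^sup>2 + 2 * (x \<bullet> (A *v y)) * t + x \<bullet> (A *v x)" for t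
  proof -
    have "0 \<le> (x + t *\<^sub>R y) \<bullet> (A *v (x + t *\<^sub>R y))"
      using assms by (rule psd_nonneg)
    also have "\<dots> = (y \<bullet> (A *v y)) * t\<^sup>2 + 2 * (x \<bullet> (A *v y)) * t + x \<bullet> (A *v x)"
      using sym by (simp add: matrix_vector_right_distrib matrix_vector_mult_scaleR
          inner_add_left inner_add_right algebra_simps power2_eq_square)
    finally show ?thesis .
  qed
  show ?thesis
  proof (cases "y \<bullet> (A *v y) = 0")
    case True
    have "x \<bullet> (A *v y) = 0"
    proof (rule ccontr)
      assume nz: "x \<bullet> (A *v y) \<noteq> 0"
      \<comment> \<open>the parabola \<open>quad\<close> degenerates to a line, which takes the value \<open>-1\<close> at this argument\<close>
      have "0 \<le> 2 * (x \<bullet> (A *v y)) * (-(x \<bullet> (A *v x) + 1) / (2 * (x \<bullet> (A *v y)))) + x \<bullet> (A *v x)"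
        using quad[of "-(x \<bullet> (A *v x) + 1) / (2 * (x \<bullet> (A *v y)))"] True by simp
      also have "\<dots> = -1"
        using nz by (simp add: field_simps)
      finally show False by simp
    qed
    then show ?thesis using True by simp
  next
    case False
    then have pos: "0 < y \<bullet> (A *v y)"
      using psd_nonneg[OF assms, of y] by linarith
    have "(y \<bullet> (A *v y)) * (-(x \<bullet> (A *v y)) / (y \<bullet> (A *v y)))\<^sup>2
        + 2 * (x \<bullet> (A *v y)) * (-(x \<bullet> (A *v y)) / (y \<bullet> (A *v y)))
        = - ((x \<bullet> (A *v y))\<^sup>2 / (y \<bullet> (A *v y)))"
      using pos by (simp add: field_simps power2_eq_square)
    then have "(x \<bullet> (A *v y))\<^sup>2 / (y \<bullet> (A *v y)) \<le> x \<bullet> (A *v x)"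
      using quad[of "-(x \<bullet> (A *v y)) / (y \<bullet> (A *v y))"] by linarith
    then show ?thesis
      using pos by (simp add: pos_divide_le_eq)
  qed
qed

lemma matrix_entry_inner: "A $ i $ j = axis i 1 \<bullet> (A *v axis j 1)" for A :: "real^'n^'m"
  by (simp add: matrix_vector_mul_component inner_axis inner_axis' )

lemma trace_eq_sum_forms: "trace A = (\<Sum>i\<in>UNIV. axis i 1 \<bullet> (A *v axis i 1))" for A :: "real^'n^'n"
  by (simp add: trace_def matrix_entry_inner)

lemma form_eq_sum_entries: "x \<bullet> (A *v y) = (\<Sum>i\<in>UNIV. \<Sum>j\<in>UNIV. x $ i * y $ j * A $ i $ j)"
  for A :: "real^'n^'m"
  by (simp add: inner_vec_def matrix_vector_mult_def sum_distrib_left algebra_simps)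

text \<open>The largest eigenvalue is at most the trace. Instead of a diagonalisation the proof uses
  \<open>|A\<^sub>i\<^sub>j| \<le> sqrt (A\<^sub>i\<^sub>i A\<^sub>j\<^sub>j)\<close>, which bounds the form by a perfect square.\<close>

lemma psd_form_le_trace:
  assumes "psd A"
  shows "v \<bullet> (A *v v) \<le> (norm v)\<^sup>2 * trace A"
proof -
  have diag: "0 \<le> A $ i $ i" for i
    using psd_nonneg[OF assms, of "axis i 1"] by (simp add: matrix_entry_inner)
  have entry: "\<bar>A $ i $ j\<bar> \<le> sqrt (A $ i $ i) * sqrt (A $ j $ j)" for i j
  proof -
    have "(A $ i $ j)\<^sup>2 \<le> A $ i $ i * A $ j $ j"
      using psd_cauchy_schwarz[OF assms, of "axis i 1" "axis j 1"] by (simp add: matrix_entry_inner)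
    then have "sqrt ((A $ i $ j)\<^sup>2) \<le> sqrt (A $ i $ i * A $ j $ j)"
      by (rule real_sqrt_le_mono)
    then show ?thesis by (simp add: real_sqrt_mult)
  qed
  have "v \<bullet> (A *v v) \<le> (\<Sum>i\<in>UNIV. \<Sum>j\<in>UNIV. (\<bar>v $ i\<bar> * sqrt (A $ i $ i)) * (\<bar>v $ j\<bar> * sqrt (A $ j $ j)))"
    unfolding form_eq_sum_entries
  proof (intro sum_mono)
    fix i j
    have "v $ i * v $ j * A $ i $ j \<le> \<bar>v $ i\<bar> * \<bar>v $ j\<bar> * \<bar>A $ i $ j\<bar>"
      by (metis abs_ge_self abs_mult)
    also have "\<dots> \<le> \<bar>v $ i\<bar> * \<bar>v $ j\<bar> * (sqrt (A $ i $ i) * sqrt (A $ j $ j))"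
      by (intro mult_left_mono entry) simp
    finally show "v $ i * v $ j * A $ i $ j \<le> (\<bar>v $ i\<bar> * sqrt (A $ i $ i)) * (\<bar>v $ j\<bar> * sqrt (A $ j $ j))"
      by (simp add: mult_ac)
  qed
  also have "\<dots> = (\<Sum>i\<in>UNIV. \<bar>v $ i\<bar> * sqrt (A $ i $ i))\<^sup>2"
    by (simp add: power2_eq_square sum_product)
  also have "\<dots> \<le> (\<Sum>i\<in>UNIV. \<bar>v $ i\<bar>\<^sup>2) * (\<Sum>i\<in>UNIV. (sqrt (A $ i $ i))\<^sup>2)"
    by (rule Cauchy_Schwarz_ineq_sum)
  also have "\<dots> = (norm v)\<^sup>2 * trace A"
    unfolding power2_norm_eq_inner using diag
    by (simp add: trace_def inner_vec_def power2_eq_square)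
  finally show ?thesis .
qed

text \<open>The overloaded multiplication of this type, and with it the overloaded power, acts entry by entry;
  these are the powers for the matrix product.\<close>

primrec mpow :: "real^'n^'n \<Rightarrow> nat \<Rightarrow> real^'n^'n" where
  "mpow A 0 = mat 1"
| "mpow A (Suc p) = A ** mpow A p"

lemma mpow_Suc_right: "mpow A (Suc p) = mpow A p ** A"
  by (induction p) (simp_all add: matrix_mul_assoc)

lemma mpow_add: "mpow A (i + j) = mpow A i ** mpow A j"
  by (induction i) (simp_all add: matrix_mul_assoc)

lemma mpow_self_adjoint: "psd A \<Longrightarrow> x \<bullet> (mpow A p *v y) = (mpow A p *v x) \<bullet> y"
proof (induction p arbitrary: x y)
  case (Suc p)
  have "x \<bullet> (mpow A (Suc p) *v y) = (mpow A p *v (A *v x)) \<bullet> y"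
    using Suc by (simp add: psd_self_adjoint flip: matrix_vector_mul_assoc)
  then show ?case
    by (simp add: matrix_vector_mul_assoc flip: mpow_Suc_right del: mpow.simps)
qed simp

lemma psd_mpow:
  assumes "psd A"
  shows "psd (mpow A p)"
proof -
  have "0 \<le> x \<bullet> (mpow A p *v x)" for x
  proof (cases "even p")
    case True
    then obtain k where "p = k + k" by (metis evenE mult_2)
    then have "x \<bullet> (mpow A p *v x) = (mpow A k *v x) \<bullet> (mpow A k *v x)"
      by (simp add: mpow_add mpow_self_adjoint[OF assms, of x] flip: matrix_vector_mul_assoc)
    then show ?thesis by simp
  next
    case False
    then obtain k where "p = k + Suc k" by (metis oddE mult_2 add_Suc_right Suc_eq_plus1)
    then have "x \<bullet> (mpow A p *v x) = x \<bullet> (mpow A k *v (A *v (mpow A k *v x)))"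
      by (simp only: mpow_add mpow.simps matrix_vector_mul_assoc)
    also have "\<dots> = (mpow A k *v x) \<bullet> (A *v (mpow A k *v x))"
      by (rule mpow_self_adjoint[OF assms])
    finally have "x \<bullet> (mpow A p *v x) = (mpow A k *v x) \<bullet> (A *v (mpow A k *v x))" .
    then show ?thesis using psd_nonneg[OF assms] by simp
  qed
  then show ?thesis
    using mpow_self_adjoint[OF assms] by (simp add: psd_def)
qed

text \<open>The ratios \<open>c (p + 1) / c p\<close> increase. The statement avoids division because moments may vanish;
  by log-convexity a vanishing moment forces all later ones to vanish.\<close>

lemma log_convex_ratio_mono:
  fixes c :: "nat \<Rightarrow> real"
  assumes nonneg: "\<And>p. 0 \<le> c p"
    and log_convex: "\<And>p. (c (Suc p))\<^sup>2 \<le> c p * c (Suc (Suc p))"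
    and "i \<le> j"
  shows "c (Suc i) * c j \<le> c i * c (Suc j)"
  using \<open>i \<le> j\<close>
proof (induction j rule: dec_induct)
  case (step j)
  show ?case
  proof (cases "c j = 0")
    case True
    then have "c (Suc j) = 0"
      using log_convex[of j] by simp
    then show ?thesis using nonneg by simp
  next
    case False
    then have pos: "0 < c j" using nonneg[of j] by simp
    have "c j * (c (Suc i) * c (Suc j)) = (c (Suc i) * c j) * c (Suc j)"
      by simp
    also have "\<dots> \<le> (c i * c (Suc j)) * c (Suc j)"
      using step.IH nonneg by (intro mult_right_mono) auto
    also have "\<dots> \<le> c i * (c j * c (Suc (Suc j)))"
      using mult_left_mono[OF log_convex[of j] nonneg[of i]] by (simp add: power2_eq_square mult_ac)
    finally show ?thesis
      using pos by (simp add: mult.left_commute)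
  qed
qed simp

text \<open>By the monotonicity of ratios the product \<open>c i * c j\<close> grows when the indices are spread apart,
  one unit at a time, until the smaller one is \<open>0\<close>.\<close>

lemma log_convex_product_le:
  fixes c :: "nat \<Rightarrow> real"
  assumes nonneg: "\<And>p. 0 \<le> c p"
    and log_convex: "\<And>p. (c (Suc p))\<^sup>2 \<le> c p * c (Suc (Suc p))"
  shows "c i * c j \<le> c 0 * c (i + j)"
proof -
  have le: "c i * c j \<le> c 0 * c (i + j)" if "i \<le> j" for i j
    using that
  proof (induction i arbitrary: j)
    case (Suc i)
    have "c (Suc i) * c j \<le> c i * c (Suc j)"
      using Suc.prems by (intro log_convex_ratio_mono nonneg log_convex) simp
    also have "\<dots> \<le> c 0 * c (i + Suc j)"
      using Suc.prems by (intro Suc.IH) simp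
    finally show ?case by simp
  qed simp
  show ?thesis
    using le[of i j] le[of j i] by (cases "i \<le> j") (simp_all add: mult.commute add.commute)
qed

text \<open>In terms of the spectral measure of \<open>A\<close> at \<open>a\<close> this is Chebyshev's association inequality for the
  increasing functions \<open>t\<^sup>i\<close> and \<open>t\<^sup>j\<close>. Here it follows from the log-convexity of the
  moments, which is the Cauchy--Schwarz inequality for the semidefinite form \<open>A\<^sup>p\<close>.\<close>

lemma psd_moment_product_le:
  assumes "psd A"
  shows "(a \<bullet> (mpow A i *v a)) * (a \<bullet> (mpow A j *v a)) \<le> (norm a)\<^sup>2 * (a \<bullet> (mpow A (i + j) *v a))"
proof -
  have "(a \<bullet> (mpow A (Suc p) *v a))\<^sup>2 \<le> (a \<bullet> (mpow A p *v a)) * (a \<bullet> (mpow A (Suc (Suc p)) *v a))" for p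
  proof -
    have 1: "a \<bullet> (mpow A p *v (A *v a)) = a \<bullet> (mpow A (Suc p) *v a)"
      unfolding mpow_Suc_right by (simp add: matrix_vector_mul_assoc)
    have 2: "(A *v a) \<bullet> (mpow A p *v (A *v a)) = a \<bullet> (mpow A (Suc (Suc p)) *v a)"
      unfolding mpow.simps(2)[of A "Suc p"] unfolding mpow_Suc_right
      by (simp add: psd_self_adjoint[OF assms] flip: matrix_vector_mul_assoc)
    show ?thesis
      using psd_cauchy_schwarz[OF psd_mpow[OF assms], of a p "A *v a"] unfolding 1 2 .
  qed
  then show ?thesis
    using log_convex_product_le[of "\<lambda>p. a \<bullet> (mpow A p *v a)" i j]
      psd_nonneg[OF psd_mpow[OF assms]] by (simp add: power2_norm_eq_inner)
qed

text \<open>Jensen's inequality for the spectral measure of \<open>A\<close> at \<open>v\<close>.\<close>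

lemma psd_power_form_le:
  assumes "psd A" and "norm v = 1"
  shows "(v \<bullet> (A *v v)) ^ p \<le> v \<bullet> (mpow A p *v v)"
proof (induction p)
  case 0
  then show ?case using assms(2) by (simp add: dot_square_norm)
next
  case (Suc p)
  have "(v \<bullet> (A *v v)) ^ Suc p \<le> (v \<bullet> (mpow A 1 *v v)) * (v \<bullet> (mpow A p *v v))"
    using Suc mult_left_mono[OF Suc psd_nonneg[OF assms(1), of v]] by simp
  also have "\<dots> \<le> v \<bullet> (mpow A (Suc p) *v v)"
    using psd_moment_product_le[OF assms(1), of v 1 p] assms(2) by simp
  finally show ?case .
qed

section \<open>The matrix exponential under rank-one perturbations\<close>

lemma norm_mpow_mult_le:
  fixes A :: "real^'n^'n"
  shows "norm (mpow A p *v x) \<le> onorm ((*v) A) ^ p * norm x"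
proof (induction p)
  case (Suc p)
  have "norm (mpow A (Suc p) *v x) \<le> onorm ((*v) A) * norm (mpow A p *v x)"
    using onorm[OF matrix_vector_mul_bounded_linear, of A "mpow A p *v x"]
    by (simp flip: matrix_vector_mul_assoc)
  also have "\<dots> \<le> onorm ((*v) A) * (onorm ((*v) A) ^ p * norm x)"
    by (intro mult_left_mono Suc onorm_pos_le matrix_vector_mul_bounded_linear)
  finally show ?case by simp
qed simp

definition mexp :: "real^'n^'n \<Rightarrow> real^'n^'n" where
  "mexp A = (\<Sum>p. mpow A p /\<^sub>R fact p)"

lemma summable_mexp:
  fixes A :: "real^'n^'n"
  shows "summable (\<lambda>p. mpow A p /\<^sub>R fact p)"
proof -
  have bound: "norm (mpow A p) \<le> (real CARD('n))\<^sup>2 * onorm ((*v) A) ^ p" for p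
  proof -
    have entry: "\<bar>mpow A p $ i $ j\<bar> \<le> onorm ((*v) A) ^ p" for i j
    proof -
      have "\<bar>mpow A p $ i $ j\<bar> \<le> norm (axis i 1 :: real^'n) * norm (mpow A p *v axis j 1)"
        unfolding matrix_entry_inner by (rule Cauchy_Schwarz_ineq2)
      also have "\<dots> \<le> onorm ((*v) A) ^ p"
        using norm_mpow_mult_le[of A p "axis j 1"] by simp
      finally show ?thesis .
    qed
    have "norm (mpow A p) \<le> (\<Sum>i\<in>UNIV. norm (mpow A p $ i))"
      unfolding norm_vec_def by (rule L2_set_le_sum) simp
    also have "\<dots> \<le> (\<Sum>i\<in>UNIV. \<Sum>j\<in>UNIV. \<bar>mpow A p $ i $ j\<bar>)"
      by (intro sum_mono norm_le_l1_cart)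
    also have "\<dots> \<le> (\<Sum>i\<in>(UNIV::'n set). \<Sum>j\<in>(UNIV::'n set). onorm ((*v) A) ^ p)"
      by (intro sum_mono entry)
    finally show ?thesis by (simp add: power2_eq_square)
  qed
  have "summable (\<lambda>p. (real CARD('n))\<^sup>2 * (onorm ((*v) A) ^ p /\<^sub>R fact p))"
    by (intro summable_mult summable_exp_generic)
  then show ?thesis
  proof (rule summable_comparison_test')
    show "norm (mpow A p /\<^sub>R fact p) \<le> (real CARD('n))\<^sup>2 * (onorm ((*v) A) ^ p /\<^sub>R fact p)" for p
      using mult_left_mono[OF bound[of p], of "inverse (fact p)"] by (simp add: mult_ac)
  qed
qed

lemma mexp_sums:
  fixes f :: "real^'n^'n \<Rightarrow> real"
  assumes "linear f"
  shows "(\<lambda>p. f (mpow A p) / fact p) sums f (mexp A)"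
proof -
  interpret bounded_linear f
    using assms by (simp add: linear_conv_bounded_linear)
  have "(\<lambda>p. f (mpow A p /\<^sub>R fact p)) sums f (mexp A)"
    unfolding mexp_def by (intro sums summable_sums summable_mexp)
  then show ?thesis
    by (simp add: scaleR divide_inverse mult.commute)
qed

lemma trace_mexp_sums: "(\<lambda>p. trace (mpow A p) / fact p) sums trace (mexp A)"
  for A :: "real^'n^'n"
  by (rule mexp_sums, rule linearI) (simp_all add: trace_def sum.distrib sum_distrib_left)

lemma form_mexp_sums: "(\<lambda>p. (x \<bullet> (mpow A p *v y)) / fact p) sums (x \<bullet> (mexp A *v y))"
  for A :: "real^'n^'n"
  by (rule mexp_sums, rule linearI)
    (simp_all add: matrix_vector_mult_add_rdistrib inner_add_right scaleR_matrix_vector_assoc[symmetric])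

lemma form_mexp_nonneg:
  assumes "psd A"
  shows "0 \<le> x \<bullet> (mexp A *v x)"
  using psd_nonneg[OF psd_mpow[OF assms]]
  by (intro sums_le[OF _ sums_zero form_mexp_sums]) simp

text \<open>The trace of the exponential controls the largest eigenvalue, so that a bound on its expectation
  yields a tail bound. The power series reduces the claim to \<open>psd_power_form_le\<close> and \<open>psd_form_le_trace\<close>.\<close>

lemma exp_form_le_trace_mexp:
  assumes "psd A" and "norm v = 1"
  shows "exp (v \<bullet> (A *v v)) \<le> trace (mexp A)"
proof -
  have "(v \<bullet> (A *v v)) ^ p \<le> trace (mpow A p)" for p
    using psd_power_form_le[OF assms, of p] psd_form_le_trace[OF psd_mpow[OF assms(1)], of v p] assms(2)
    by simp
  then have "(v \<bullet> (A *v v)) ^ p /\<^sub>R fact p \<le> trace (mpow A p) / fact p" for p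
    by (simp add: divide_inverse mult.commute mult_left_mono)
  then show ?thesis
    by (rule sums_le[OF _ exp_converges trace_mexp_sums])
qed

lemma trace_mexp_scaled_identity: "trace (mexp (c *\<^sub>R mat 1 :: real^'n^'n)) = real CARD('n) * exp c"
proof -
  have pow: "mpow (c *\<^sub>R mat 1 :: real^'n^'n) p = c ^ p *\<^sub>R mat 1" for p
    by (induction p) (simp_all add: scalar_matrix_assoc[symmetric, of c "mat 1"])
  have "(\<lambda>p. real CARD('n) * (c ^ p /\<^sub>R fact p)) sums (real CARD('n) * exp c)"
    by (intro sums_mult exp_converges)
  moreover have "trace (mpow (c *\<^sub>R mat 1 :: real^'n^'n) p) / fact p = real CARD('n) * (c ^ p /\<^sub>R fact p)" for p
    unfolding pow by (simp add: trace_def mat_def divide_inverse)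
  ultimately have "(\<lambda>p. trace (mpow (c *\<^sub>R mat 1 :: real^'n^'n) p) / fact p) sums (real CARD('n) * exp c)"
    by (simp only:)
  with trace_mexp_sums show ?thesis
    by (rule sums_unique2)
qed

definition outer :: "real^'n \<Rightarrow> real^'n^'n" where
  "outer a = (\<chi> i j. a $ i * a $ j)"

lemma outer_mult: "outer a *v x = (a \<bullet> x) *\<^sub>R a"
  by (simp add: outer_def matrix_vector_mult_def vec_eq_iff inner_vec_def sum_distrib_left mult_ac)

lemma psd_outer: "psd (outer a)"
  by (simp add: psd_def outer_mult inner_commute)

lemma trace_mult_outer: "trace (A ** outer a) = a \<bullet> (A *v a)"
  by (simp add: trace_def outer_def matrix_matrix_mult_def inner_vec_def matrix_vector_mult_def
      sum_distrib_left mult_ac)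

text \<open>For \<open>c p = \<langle>a, A\<^sup>p a\<rangle>\<close> this is \<open>\<langle>a, A\<^sup>i (A + r I)\<^sup>q a\<rangle>\<close>, expanded by the binomial theorem so that only
  the scalar moments occur.\<close>

definition shifted_moment :: "real \<Rightarrow> (nat \<Rightarrow> real) \<Rightarrow> nat \<Rightarrow> nat \<Rightarrow> real" where
  "shifted_moment r c i q = (\<Sum>k\<le>q. real (q choose k) * r ^ k * c (i + (q - k)))"

lemma shifted_moment_0 [simp]: "shifted_moment r c i 0 = c i"
  by (simp add: shifted_moment_def)

lemma shifted_moment_Suc:
  "shifted_moment r c i (Suc q) = shifted_moment r c (Suc i) q + r * shifted_moment r c i q"
proof -
  have "shifted_moment r c i (Suc q)
      = c (i + Suc q) + (\<Sum>k\<le>q. real (Suc q choose Suc k) * r ^ Suc k * c (i + (q - k)))"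
    unfolding shifted_moment_def by (simp add: sum.atMost_Suc_shift del: binomial_Suc_Suc sum.atMost_Suc)
  also have "\<dots> = (c (i + Suc q) + (\<Sum>k\<le>q. real (q choose Suc k) * r ^ Suc k * c (i + (q - k))))
      + r * shifted_moment r c i q"
    by (simp add: shifted_moment_def sum.distrib sum_distrib_left algebra_simps)
  also have "c (i + Suc q) + (\<Sum>k\<le>q. real (q choose Suc k) * r ^ Suc k * c (i + (q - k)))
      = (\<Sum>k\<le>Suc q. real (q choose k) * r ^ k * c (i + (Suc q - k)))"
    by (simp add: sum.atMost_Suc_shift del: sum.atMost_Suc)
  also have "\<dots> = shifted_moment r c (Suc i) q"
    by (simp add: shifted_moment_def Suc_diff_le)
  finally show ?thesis .
qed

text \<open>The scalar form of \<open>exp (A + r I) = e\<^sup>r exp A\<close>.\<close>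

lemma shifted_moment_exp_sums:
  assumes nonneg: "\<And>k. 0 \<le> c k" "0 \<le> r" and "(\<lambda>k. c k / fact k) sums s"
  shows "(\<lambda>p. shifted_moment r c 0 p / fact p) sums (exp r * s)"
proof -
  have "(\<lambda>p. \<Sum>k\<le>p. (r ^ k / fact k) * (c (p - k) / fact (p - k)))
      sums ((\<Sum>k. r ^ k / fact k) * (\<Sum>k. c k / fact k))"
  proof (rule Cauchy_product_sums)
    show "summable (\<lambda>k. norm (r ^ k / fact k))"
      using summable_exp_generic[of r] nonneg by (simp add: divide_inverse mult.commute)
    show "summable (\<lambda>k. norm (c k / fact k))"
      using nonneg sums_summable[OF assms(3)] by simp
  qed
  moreover have "(\<Sum>k. r ^ k / fact k) = exp r"
    by (simp add: exp_def divide_inverse mult.commute)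
  moreover have "(\<Sum>k\<le>p. (r ^ k / fact k) * (c (p - k) / fact (p - k))) = shifted_moment r c 0 p / fact p" for p
    unfolding shifted_moment_def sum_divide_distrib
    by (intro sum.cong) (simp_all add: binomial_fact)
  ultimately show ?thesis
    using sums_unique[OF assms(3)] by simp
qed

lemma matrix_mult_add_rdistrib: "(A + B) ** C = A ** C + B ** C" for A B :: "real^'n^'m"
  by (simp add: matrix_matrix_mult_def vec_eq_iff sum.distrib distrib_right)

context
  fixes C :: "real^'n^'n" and a :: "real^'n" and r :: real
  assumes C: "psd C" and a: "(norm a)\<^sup>2 \<le> r"
begin

lemma mixed_moment_Suc:
  "a \<bullet> (mpow C i *v (mpow (C + outer a) (Suc q) *v a))
    = a \<bullet> (mpow C (Suc i) *v (mpow (C + outer a) q *v a))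
      + (a \<bullet> (mpow (C + outer a) q *v a)) * (a \<bullet> (mpow C i *v a))"
proof -
  have "mpow (C + outer a) (Suc q) *v a
      = C *v (mpow (C + outer a) q *v a) + (a \<bullet> (mpow (C + outer a) q *v a)) *\<^sub>R a"
    by (simp add: matrix_vector_mult_add_rdistrib outer_mult flip: matrix_vector_mul_assoc)
  moreover have "mpow C i *v (C *v x) = mpow C (Suc i) *v x" for x
    unfolding mpow_Suc_right by (simp add: matrix_vector_mul_assoc)
  ultimately show ?thesis
    by (simp add: matrix_vector_right_distrib matrix_vector_mult_scaleR inner_add_right del: mpow.simps)
qed

text \<open>Along \<open>a\<close>, the perturbation \<open>a a\<^sup>T\<close> acts at most like the shift \<open>r I\<close>. One more factor
  \<open>C + a a\<^sup>T\<close> adds a product of two moments; the induction hypothesis turns the first one into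
  moments of \<open>C\<close>, and \<open>psd_moment_product_le\<close> merges the product into \<open>r\<close> times a single moment, which is what
  one more factor \<open>C + r I\<close> would add.\<close>

lemma mixed_moment_le:
  "a \<bullet> (mpow C i *v (mpow (C + outer a) q *v a)) \<le> shifted_moment r (\<lambda>p. a \<bullet> (mpow C p *v a)) i q"
proof (induction q arbitrary: i)
  case (Suc q)
  let ?c = "\<lambda>p. a \<bullet> (mpow C p *v a)"
  have c_nonneg: "0 \<le> ?c p" for p
    by (rule psd_nonneg[OF psd_mpow[OF C]])
  have prod_le: "?c j * ?c i \<le> r * ?c (i + j)" for j
  proof -
    have "?c j * ?c i \<le> (norm a)\<^sup>2 * ?c (i + j)"
      using psd_moment_product_le[OF C, of a i j] by (simp add: mult.commute)
    also have "\<dots> \<le> r * ?c (i + j)"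
      by (intro mult_right_mono a c_nonneg)
    finally show ?thesis .
  qed
  have "shifted_moment r ?c 0 q * ?c i \<le> r * shifted_moment r ?c i q"
    unfolding shifted_moment_def sum_distrib_left sum_distrib_right
  proof (intro sum_mono)
    fix k
    have "(real (q choose k) * r ^ k) * (?c (q - k) * ?c i)
        \<le> (real (q choose k) * r ^ k) * (r * ?c (i + (q - k)))"
      using prod_le[of "q - k"] order_trans[OF zero_le_power2 a]
      by (intro mult_left_mono mult_nonneg_nonneg zero_le_power) simp_all
    then show "real (q choose k) * r ^ k * ?c (0 + (q - k)) * ?c i
        \<le> r * (real (q choose k) * r ^ k * ?c (i + (q - k)))"
      by (simp only: mult_ac add_0)
  qed
  moreover have "(a \<bullet> (mpow (C + outer a) q *v a)) * ?c i \<le> shifted_moment r ?c 0 q * ?c i"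
    using Suc.IH[of 0] by (intro mult_right_mono c_nonneg) simp
  ultimately show ?case
    unfolding mixed_moment_Suc shifted_moment_Suc using Suc.IH[of "Suc i"] by linarith
qed simp

text \<open>The terms containing \<open>a a\<^sup>T\<close> are products of quadratic forms of semidefinite matrices.\<close>

lemma moment_le_mixed_moment:
  "a \<bullet> (mpow C (i + q) *v a) \<le> a \<bullet> (mpow C i *v (mpow (C + outer a) q *v a))"
proof (induction q arbitrary: i)
  case (Suc q)
  have "0 \<le> (a \<bullet> (mpow (C + outer a) q *v a)) * (a \<bullet> (mpow C i *v a))"
    by (intro mult_nonneg_nonneg psd_nonneg psd_mpow psd_add C psd_outer)
  then show ?case
    unfolding mixed_moment_Suc using Suc.IH[of "Suc i"] by (simp del: mpow.simps)
qed simp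

text \<open>The factors \<open>C\<close> are exchanged for \<open>C + a a\<^sup>T\<close> one at a time; cyclicity of the trace turns each
  difference into a quadratic form.\<close>

lemma trace_mpow_rank_one:
  "trace (mpow (C + outer a) p) - trace (mpow C p)
    = (\<Sum>i<p. a \<bullet> (mpow C (p - Suc i) *v (mpow (C + outer a) i *v a)))"
proof -
  let ?B = "C + outer a"
  have step: "trace (mpow C (p - Suc i) ** mpow ?B (Suc i)) - trace (mpow C (p - i) ** mpow ?B i)
      = a \<bullet> (mpow C (p - Suc i) *v (mpow ?B i *v a))" if "i < p" for i
  proof -
    let ?X = "mpow C (p - Suc i)" and ?Y = "mpow ?B i"
    have "mpow C (p - i) = ?X ** C"
      using that by (simp add: Suc_diff_Suc mpow_Suc_right[symmetric] del: mpow.simps)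
    then have "trace (?X ** mpow ?B (Suc i)) - trace (mpow C (p - i) ** ?Y) = trace ((?X ** outer a) ** ?Y)"
      by (simp add: matrix_add_ldistrib matrix_mult_add_rdistrib trace_add matrix_mul_assoc)
    also have "\<dots> = trace ((?Y ** ?X) ** outer a)"
      by (subst trace_mul_sym) (simp add: matrix_mul_assoc)
    also have "\<dots> = a \<bullet> (?Y *v (?X *v a))"
      by (simp add: trace_mult_outer matrix_vector_mul_assoc)
    also have "\<dots> = a \<bullet> (?X *v (?Y *v a))"
      using mpow_self_adjoint[OF psd_add[OF C psd_outer], of a a i "?X *v a"]
        mpow_self_adjoint[OF C, of a "p - Suc i" "?Y *v a"]
      by (simp add: inner_commute)
    finally show ?thesis .
  qed
  have "trace (mpow ?B p) - trace (mpow C p)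
      = (\<Sum>i<p. trace (mpow C (p - Suc i) ** mpow ?B (Suc i)) - trace (mpow C (p - i) ** mpow ?B i))"
    by (subst sum_lessThan_telescope) simp
  then show ?thesis
    using step by simp
qed

lemma form_mexp_rank_one_le:
  "a \<bullet> (mexp (C + outer a) *v a) \<le> exp r * (a \<bullet> (mexp C *v a))"
proof -
  have "(\<lambda>p. shifted_moment r (\<lambda>p. a \<bullet> (mpow C p *v a)) 0 p / fact p)
      sums (exp r * (a \<bullet> (mexp C *v a)))"
    using psd_nonneg[OF psd_mpow[OF C]] order_trans[OF zero_le_power2 a]
    by (intro shifted_moment_exp_sums form_mexp_sums) auto
  moreover have "(a \<bullet> (mpow (C + outer a) p *v a)) / fact p
      \<le> shifted_moment r (\<lambda>p. a \<bullet> (mpow C p *v a)) 0 p / fact p" for p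
    using mixed_moment_le[of 0 p] by (simp add: divide_right_mono)
  ultimately show ?thesis
    by (intro sums_le[OF _ form_mexp_sums])
qed

text \<open>The factor \<open>(e\<^sup>r - 1)/r\<close> is the slope of the chord of \<open>exp\<close> over \<open>[0, r]\<close>, as in the scalar Chernoff
  argument. The sum over the positions of the perturbation telescopes because
  \<open>(C + r I) - C = r I\<close>.\<close>

lemma trace_mexp_rank_one_le:
  assumes "0 < r"
  shows "trace (mexp (C + outer a)) \<le> trace (mexp C) + (exp r - 1) / r * (a \<bullet> (mexp C *v a))"
proof -
  let ?c = "\<lambda>p. a \<bullet> (mpow C p *v a)"
  let ?d = "shifted_moment r ?c"
  have "r * (trace (mpow (C + outer a) p) - trace (mpow C p)) \<le> ?d 0 p - ?c p" for p
  proof -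
    have "r * (trace (mpow (C + outer a) p) - trace (mpow C p)) \<le> (\<Sum>i<p. r * ?d (p - Suc i) i)"
      unfolding trace_mpow_rank_one sum_distrib_left
      using assms by (intro sum_mono mult_left_mono mixed_moment_le) simp
    also have "\<dots> = (\<Sum>i<p. ?d (p - Suc i) (Suc i) - ?d (p - i) i)"
      by (intro sum.cong) (simp_all add: shifted_moment_Suc Suc_diff_Suc)
    also have "\<dots> = ?d 0 p - ?c p"
      by (subst sum_lessThan_telescope) simp
    finally show ?thesis .
  qed
  then have "r * (trace (mpow (C + outer a) p) / fact p - trace (mpow C p) / fact p)
      \<le> ?d 0 p / fact p - ?c p / fact p" for p
    by (metis (no_types, lifting) diff_divide_distrib divide_right_mono fact_ge_zero times_divide_eq_right)
  moreover have "(\<lambda>p. r * (trace (mpow (C + outer a) p) / fact p - trace (mpow C p) / fact p))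
      sums (r * (trace (mexp (C + outer a)) - trace (mexp C)))"
    by (intro sums_mult sums_diff trace_mexp_sums)
  moreover have "(\<lambda>p. ?d 0 p / fact p - ?c p / fact p)
      sums (exp r * (a \<bullet> (mexp C *v a)) - a \<bullet> (mexp C *v a))"
    using psd_nonneg[OF psd_mpow[OF C]] assms
    by (intro sums_diff shifted_moment_exp_sums form_mexp_sums) auto
  ultimately have "r * (trace (mexp (C + outer a)) - trace (mexp C))
      \<le> exp r * (a \<bullet> (mexp C *v a)) - a \<bullet> (mexp C *v a)"
    by (rule sums_le)
  then show ?thesis
    using assms by (simp add: field_simps)
qed

text \<open>The tangent of the convex function \<open>s \<mapsto> tr exp (C + s a a\<^sup>T)\<close> at \<open>s = 0\<close>.\<close>

lemma trace_mexp_rank_one_ge: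
  "trace (mexp C) + a \<bullet> (mexp C *v a) \<le> trace (mexp (C + outer a))"
proof -
  let ?c = "\<lambda>p. a \<bullet> (mpow C p *v a)"
  have "real p * ?c (p - 1) \<le> trace (mpow (C + outer a) p) - trace (mpow C p)" for p
  proof -
    have "(\<Sum>i<p. ?c (p - 1)) \<le> trace (mpow (C + outer a) p) - trace (mpow C p)"
      unfolding trace_mpow_rank_one
    proof (intro sum_mono)
      fix i assume "i \<in> {..<p}"
      then show "?c (p - 1) \<le> a \<bullet> (mpow C (p - Suc i) *v (mpow (C + outer a) i *v a))"
        using moment_le_mixed_moment[of "p - Suc i" i] by simp
    qed
    then show ?thesis by simp
  qed
  then have "real p * ?c (p - 1) / fact p \<le> trace (mpow (C + outer a) p) / fact p - trace (mpow C p) / fact p" for p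
    by (simp add: divide_right_mono flip: diff_divide_distrib)
  moreover have "(\<lambda>p. real p * ?c (p - 1) / fact p) sums (a \<bullet> (mexp C *v a))"
  proof -
    have "(\<lambda>p. real (Suc p) * ?c (Suc p - 1) / fact (Suc p)) sums (a \<bullet> (mexp C *v a))"
    proof -
      have "real (Suc p) * ?c (Suc p - 1) / fact (Suc p) = ?c p / fact p" for p
        by (simp del: of_nat_Suc)
      then show ?thesis using form_mexp_sums[of a C a] by simp
    qed
    then show ?thesis
      by (subst (asm) sums_Suc_iff) simp
  qed
  moreover have "(\<lambda>p. trace (mpow (C + outer a) p) / fact p - trace (mpow C p) / fact p)
      sums (trace (mexp (C + outer a)) - trace (mexp C))"
    by (intro sums_diff trace_mexp_sums)
  ultimately have "a \<bullet> (mexp C *v a) \<le> trace (mexp (C + outer a)) - trace (mexp C)"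
    by (rule sums_le)
  then show ?thesis by simp
qed

end

text \<open>The function \<open>s \<mapsto> tr exp (C + s a a\<^sup>T)\<close> on \<open>[0, 1]\<close> has derivative \<open>\<langle>a, exp (C + s a a\<^sup>T) a\<rangle>\<close>, which
  by \<open>form_mexp_rank_one_le\<close> is at least \<open>exp (- r (1 - s))\<close> times its value at \<open>s = 1\<close>. The sum is
  the left Riemann sum of \<open>\<integral> exp (- r (1 - s)) ds\<close> with \<open>N\<close> nodes; it is obtained by adding \<open>a a\<^sup>T\<close> in \<open>N\<close> equal parts and
  using the tangent bound for each of them.\<close>

lemma trace_mexp_rank_one_subdivided:
  fixes C :: "real^'n^'n"
  assumes C: "psd C" and a: "(norm a)\<^sup>2 \<le> r" and N: "0 < N"
  shows "trace (mexp C) + (\<Sum>k<N. exp (- (real (N - k) * r / N))) / N * (a \<bullet> (mexp (C + outer a) *v a))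
    \<le> trace (mexp (C + outer a))"
proof -
  define b where "b = a /\<^sub>R sqrt N"
  define B where "B k = C + real k *\<^sub>R outer b" for k
  have B_Suc: "B (Suc k) = B k + outer b" for k
    by (simp add: B_def algebra_simps)
  have B_0: "B 0 = C"
    by (simp add: B_def)
  have B_N: "B N = C + outer a"
    using N by (simp add: B_def b_def outer_def vec_eq_iff field_simps)
  have psd_B: "psd (B k)" for k
    by (induction k) (simp_all add: B_0 C B_Suc psd_add psd_outer)
  have b: "(norm b)\<^sup>2 \<le> r / N"
    using divide_right_mono[OF a, of N]
    by (simp add: b_def power_mult_distrib power_inverse divide_inverse mult.commute)
  have chain: "b \<bullet> (mexp (B (k + j)) *v b) \<le> exp (real j * r / N) * (b \<bullet> (mexp (B k) *v b))" for k j
  proof (induction j)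
    case (Suc j)
    have "b \<bullet> (mexp (B (k + Suc j)) *v b) \<le> exp (r / N) * (b \<bullet> (mexp (B (k + j)) *v b))"
      using form_mexp_rank_one_le[OF psd_B b, of "k + j"] by (simp add: B_Suc)
    also have "\<dots> \<le> exp (r / N) * (exp (real j * r / N) * (b \<bullet> (mexp (B k) *v b)))"
      by (intro mult_left_mono Suc) simp
    finally show ?case
      by (simp add: add_divide_distrib exp_add algebra_simps)
  qed simp
  have "exp (- (real (N - k) * r / N)) * (b \<bullet> (mexp (B N) *v b)) \<le> trace (mexp (B (Suc k))) - trace (mexp (B k))"
    if "k < N" for k
  proof -
    have "exp (- (real (N - k) * r / N)) * (b \<bullet> (mexp (B N) *v b)) \<le> b \<bullet> (mexp (B k) *v b)"
      using chain[of k "N - k"] that by (simp add: exp_minus field_simps)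
    also have "\<dots> \<le> trace (mexp (B (Suc k))) - trace (mexp (B k))"
      using trace_mexp_rank_one_ge[OF psd_B b, of k] by (simp add: B_Suc)
    finally show ?thesis .
  qed
  then have "(\<Sum>k<N. exp (- (real (N - k) * r / N)) * (b \<bullet> (mexp (B N) *v b)))
      \<le> (\<Sum>k<N. trace (mexp (B (Suc k))) - trace (mexp (B k)))"
    by (intro sum_mono) simp
  also have "\<dots> = trace (mexp (C + outer a)) - trace (mexp C)"
    by (subst sum_lessThan_telescope) (simp add: B_0 B_N)
  also have "b \<bullet> (mexp (B N) *v b) = (a \<bullet> (mexp (C + outer a) *v a)) / N"
    using N by (simp add: B_N b_def matrix_vector_mult_scaleR field_simps)
  finally show ?thesis
    by (simp add: sum_distrib_right flip: sum_divide_distrib)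
qed

section \<open>Sums of independent random matrices and the spectral norm\<close>

lemma trace_mexp_nonneg:
  assumes "psd A"
  shows "0 \<le> trace (mexp A)"
  unfolding trace_eq_sum_forms by (intro sum_nonneg form_mexp_nonneg assms)

lemma psd_scaleR: "psd A \<Longrightarrow> 0 \<le> c \<Longrightarrow> psd (c *\<^sub>R A)"
  unfolding psd_def scaleR_matrix_vector_assoc[symmetric] inner_scaleR_right inner_scaleR_left
  by (metis mult_nonneg_nonneg)

lemma psd_mat_1: "psd (mat 1)"
  by (simp add: psd_def)

lemma psd_0: "psd 0"
  by (simp add: psd_def)

lemma psd_sum: "(\<And>i. i \<in> I \<Longrightarrow> psd (A i)) \<Longrightarrow> psd (\<Sum>i\<in>I. A i)"
  by (induction I rule: infinite_finite_induct) (simp_all add: psd_0 psd_add)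

lemma psd_identity_minus_outer:
  assumes "(norm b)\<^sup>2 \<le> r"
  shows "psd (r *\<^sub>R mat 1 - outer b)"
proof -
  have form: "x \<bullet> ((r *\<^sub>R mat 1 - outer b) *v y) = r * (x \<bullet> y) - (b \<bullet> x) * (b \<bullet> y)" for x y
    by (simp add: matrix_vector_mult_diff_rdistrib outer_mult inner_diff_right inner_commute
        flip: scaleR_matrix_vector_assoc)
  have "(b \<bullet> x)\<^sup>2 \<le> r * (x \<bullet> x)" for x
    using Cauchy_Schwarz_ineq[of b x] mult_right_mono[OF assms, of "x \<bullet> x"]
    by (simp add: power2_norm_eq_inner)
  then have "0 \<le> x \<bullet> ((r *\<^sub>R mat 1 - outer b) *v x)" for x
    unfolding form by (simp add: power2_eq_square)
  moreover have "x \<bullet> ((r *\<^sub>R mat 1 - outer b) *v y) = ((r *\<^sub>R mat 1 - outer b) *v x) \<bullet> y" for x y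
    unfolding form inner_commute[of "_ *v x"] by (simp add: inner_commute)
  ultimately show ?thesis by (simp add: psd_def)
qed

lemma outer_scaleR: "outer (c *\<^sub>R a) = c\<^sup>2 *\<^sub>R outer a"
  by (simp add: outer_def vec_eq_iff power2_eq_square)

lemma continuous_on_mpow: "continuous_on UNIV (\<lambda>A :: real^'n^'n. mpow A p)"
  by (induction p) (auto simp: matrix_matrix_mult_def intro!: continuous_intros)

lemma borel_measurable_trace_mexp [measurable]:
  "(\<lambda>A :: real^'n^'n. trace (mexp A)) \<in> borel_measurable borel"
proof -
  have "(\<lambda>A :: real^'n^'n. trace (mexp A)) = (\<lambda>A. \<Sum>p. trace (mpow A p) / fact p)"
    using sums_unique[OF trace_mexp_sums] by auto
  moreover have "(\<lambda>A :: real^'n^'n. trace (mpow A p) / fact p) \<in> borel_measurable borel" for p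
    by (intro borel_measurable_continuous_onI)
      (auto simp: trace_def intro!: continuous_intros continuous_on_mpow)
  ultimately show ?thesis by simp
qed

lemma borel_measurable_matrix:
  assumes "\<And>i j. (\<lambda>x. F x $ i $ j) \<in> borel_measurable M"
  shows "(F :: 'a \<Rightarrow> real^'n^'m) \<in> borel_measurable M"
  using assms unfolding borel_measurable_euclidean_space[of F]
  by (auto simp: Basis_vec_def inner_axis)

lemma borel_measurable_vector_entry [measurable (raw)]:
  assumes "F \<in> borel_measurable M"
  shows "(\<lambda>x. (F x :: real^'n) $ i) \<in> borel_measurable M"
proof -
  have "(\<lambda>v :: real^'n. v $ i) \<in> borel_measurable borel"
    by (intro borel_measurable_continuous_onI continuous_intros)
  then show ?thesis using assms by measurable
qed

lemma borel_measurable_outer [measurable (raw)]: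
  assumes [measurable]: "a \<in> borel_measurable M"
  shows "(\<lambda>x. outer (a x)) \<in> borel_measurable M"
proof -
  have "outer \<in> borel_measurable borel"
    by (intro borel_measurable_continuous_onI) (auto simp: outer_def intro!: continuous_intros)
  then show ?thesis by measurable
qed

text \<open>The samples are integrated out one after the other. \<open>Q k A\<close> says that \<open>A\<close> is admissible when \<open>k\<close>
  increments are still to come; the count is needed for negative increments, which must not destroy
  semidefiniteness.\<close>

lemma iid_sum_trace_mexp_le:
  fixes Y :: "'a \<Rightarrow> real^'n^'n"
  assumes "prob_space \<sigma>" and Y[measurable]: "Y \<in> borel_measurable \<sigma>" and "0 \<le> \<rho>"
    and step: "\<And>k A. Q (Suc k) A \<Longrightarrow> (\<integral>\<^sup>+y. ennreal (trace (mexp (A + Y y))) \<partial>\<sigma>) \<le> ennreal (\<rho> * trace (mexp A))"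
    and preserved: "\<And>k A y. Q (Suc k) A \<Longrightarrow> y \<in> space \<sigma> \<Longrightarrow> Q k (A + Y y)"
    and "finite I" and "Q (card I) A"
  shows "(\<integral>\<^sup>+x. ennreal (trace (mexp (A + (\<Sum>i\<in>I. Y (x i))))) \<partial>(\<Pi>\<^sub>M i\<in>I. \<sigma>))
    \<le> ennreal (\<rho> ^ card I * trace (mexp A))"
  using \<open>finite I\<close> \<open>Q (card I) A\<close>
proof (induction I arbitrary: A rule: finite_induct)
  case empty
  then show ?case by (simp add: nn_integral_empty PiM_empty nn_integral_count_space_finite)
next
  case (insert i I)
  interpret prob_space \<sigma> by fact
  interpret product_sigma_finite "\<lambda>_. \<sigma>" ..
  have "(\<integral>\<^sup>+x. ennreal (trace (mexp (A + (\<Sum>j\<in>insert i I. Y (x j))))) \<partial>(\<Pi>\<^sub>M i\<in>insert i I. \<sigma>))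
      = (\<integral>\<^sup>+y. (\<integral>\<^sup>+x. ennreal (trace (mexp (A + (\<Sum>j\<in>insert i I. Y ((x(i := y)) j))))) \<partial>(\<Pi>\<^sub>M i\<in>I. \<sigma>)) \<partial>\<sigma>)"
    using insert.hyps by (intro product_nn_integral_insert_rev) measurable
  also have "\<dots> = (\<integral>\<^sup>+y. (\<integral>\<^sup>+x. ennreal (trace (mexp ((A + Y y) + (\<Sum>j\<in>I. Y (x j))))) \<partial>(\<Pi>\<^sub>M i\<in>I. \<sigma>)) \<partial>\<sigma>)"
  proof (intro nn_integral_cong)
    fix y x
    have "(\<Sum>j\<in>I. Y ((x(i := y)) j)) = (\<Sum>j\<in>I. Y (x j))"
      using insert.hyps by (intro sum.cong) auto
    then show "ennreal (trace (mexp (A + (\<Sum>j\<in>insert i I. Y ((x(i := y)) j)))))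
        = ennreal (trace (mexp ((A + Y y) + (\<Sum>j\<in>I. Y (x j)))))"
      using insert.hyps by (simp add: add.assoc)
  qed
  also have "\<dots> \<le> (\<integral>\<^sup>+y. ennreal (\<rho> ^ card I) * ennreal (trace (mexp (A + Y y))) \<partial>\<sigma>)"
  proof (intro nn_integral_mono)
    fix y assume "y \<in> space \<sigma>"
    then have "Q (card I) (A + Y y)"
      using insert by (intro preserved) simp_all
    then show "(\<integral>\<^sup>+x. ennreal (trace (mexp ((A + Y y) + (\<Sum>j\<in>I. Y (x j))))) \<partial>(\<Pi>\<^sub>M i\<in>I. \<sigma>))
        \<le> ennreal (\<rho> ^ card I) * ennreal (trace (mexp (A + Y y)))"
      using insert.IH[of "A + Y y"] \<open>0 \<le> \<rho>\<close> by (simp add: ennreal_mult')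
  qed
  also have "\<dots> = ennreal (\<rho> ^ card I) * (\<integral>\<^sup>+y. ennreal (trace (mexp (A + Y y))) \<partial>\<sigma>)"
    by (intro nn_integral_cmult) measurable
  also have "\<dots> \<le> ennreal (\<rho> ^ card I) * ennreal (\<rho> * trace (mexp A))"
    using insert by (intro mult_left_mono step) simp_all
  also have "\<dots> = ennreal (\<rho> ^ card (insert i I) * trace (mexp A))"
    using insert.hyps \<open>0 \<le> \<rho>\<close> by (simp add: mult_ac flip: ennreal_mult')
  finally show ?case .
qed

lemma iid_sum_trace_mexp_tail:
  fixes Y :: "'a \<Rightarrow> real^'n^'n"
  assumes \<sigma>: "prob_space \<sigma>" and Y[measurable]: "Y \<in> borel_measurable \<sigma>" and "0 \<le> \<rho>"
    and step: "\<And>k A. Q (Suc k) A \<Longrightarrow> (\<integral>\<^sup>+y. ennreal (trace (mexp (A + Y y))) \<partial>\<sigma>) \<le> ennreal (\<rho> * trace (mexp A))"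
    and preserved: "\<And>k A y. Q (Suc k) A \<Longrightarrow> y \<in> space \<sigma> \<Longrightarrow> Q k (A + Y y)"
    and "finite I" and "Q (card I) A" and "0 \<le> trace (mexp A)" and "0 < K"
  shows "measure (\<Pi>\<^sub>M i\<in>I. \<sigma>) {x \<in> space (\<Pi>\<^sub>M i\<in>I. \<sigma>). K \<le> trace (mexp (A + (\<Sum>i\<in>I. Y (x i))))}
    \<le> \<rho> ^ card I * trace (mexp A) / K"
proof -
  let ?P = "\<Pi>\<^sub>M i\<in>I. \<sigma>"
  let ?E = "{x \<in> space ?P. K \<le> trace (mexp (A + (\<Sum>i\<in>I. Y (x i))))}"
  interpret P: prob_space ?P
    by (intro prob_space_PiM \<sigma>)
  have [measurable]: "?E \<in> sets ?P" by measurable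
  have "ennreal (K * measure ?P ?E) = ennreal K * emeasure ?P ?E"
    using \<open>0 < K\<close> by (simp add: P.emeasure_eq_measure ennreal_mult')
  also have "\<dots> = (\<integral>\<^sup>+x. ennreal K * indicator ?E x \<partial>?P)"
    by (simp add: nn_integral_cmult_indicator)
  also have "\<dots> \<le> (\<integral>\<^sup>+x. ennreal (trace (mexp (A + (\<Sum>i\<in>I. Y (x i))))) \<partial>?P)"
    by (intro nn_integral_mono) (auto simp: indicator_def intro!: ennreal_leI)
  also have "\<dots> \<le> ennreal (\<rho> ^ card I * trace (mexp A))"
    using assms by (intro iid_sum_trace_mexp_le[where Q = Q]) auto
  finally have "K * measure ?P ?E \<le> \<rho> ^ card I * trace (mexp A)"
    using assms by (subst (asm) ennreal_le_iff) simp_all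
  then show ?thesis
    using \<open>0 < K\<close> by (simp add: field_simps)
qed

text \<open>For a self-adjoint matrix the spectral norm is attained by the quadratic form. The maximum \<open>q\<close> of
  the form on the sphere exists by compactness, and polarisation together with the parallelogram law
  bounds \<open>|H x|\<close> by \<open>q |x|\<close>.\<close>

lemma spectral_norm_le_form:
  fixes H :: "real^'n^'n"
  assumes sym: "\<And>x y. x \<bullet> (H *v y) = (H *v x) \<bullet> y"
  obtains v where "norm v = 1" and "spectral_norm H \<le> \<bar>v \<bullet> (H *v v)\<bar>"
proof -
  have "continuous_on (sphere 0 1) (\<lambda>v. \<bar>v \<bullet> (H *v v)\<bar>)"
    by (intro continuous_intros)
  moreover have "sphere (0 :: real^'n) 1 \<noteq> {}" by simp
  ultimately have "\<exists>v\<in>sphere 0 1. \<forall>x\<in>sphere 0 1. \<bar>x \<bullet> (H *v x)\<bar> \<le> \<bar>v \<bullet> (H *v v)\<bar>"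
    by (intro continuous_attains_sup compact_sphere)
  then obtain v where v: "v \<in> sphere 0 1"
    and max: "\<And>x. x \<in> sphere 0 1 \<Longrightarrow> \<bar>x \<bullet> (H *v x)\<bar> \<le> \<bar>v \<bullet> (H *v v)\<bar>"
    by blast
  define q where "q = \<bar>v \<bullet> (H *v v)\<bar>"
  have form: "\<bar>x \<bullet> (H *v x)\<bar> \<le> q * (norm x)\<^sup>2" for x
  proof (cases "x = 0")
    case False
    then have "\<bar>(x /\<^sub>R norm x) \<bullet> (H *v (x /\<^sub>R norm x))\<bar> \<le> q"
      unfolding q_def by (intro max) simp
    then show ?thesis
      using False by (simp add: matrix_vector_mult_scaleR abs_mult field_simps power2_eq_square)
  qed simp
  have "norm (H *v x) \<le> q * norm x" for x
  proof (cases "x = 0 \<or> H *v x = 0")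
    case True
    then show ?thesis by (auto simp: q_def)
  next
    case False
    \<comment> \<open>the direction of \<open>H x\<close>, with the length of \<open>x\<close> so that the parallelogram law gives \<open>4 |x|\<^sup>2\<close>\<close>
    define y where "y = (norm x / norm (H *v x)) *\<^sub>R (H *v x)"
    have norm_y: "norm y = norm x" using False by (simp add: y_def)
    have "y \<bullet> (H *v x) = norm x * norm (H *v x)"
      using False by (simp add: y_def dot_square_norm power2_eq_square)
    then have "4 * (norm x * norm (H *v x)) = (x + y) \<bullet> (H *v (x + y)) - (x - y) \<bullet> (H *v (x - y))"
      using sym[of x y] by (simp add: matrix_vector_right_distrib matrix_vector_mult_diff_distrib
          inner_add_left inner_add_right inner_diff_left inner_diff_right inner_commute)
    also have "\<dots> \<le> q * (norm (x + y))\<^sup>2 + q * (norm (x - y))\<^sup>2"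
      using form[of "x + y"] form[of "x - y"] by linarith
    also have "\<dots> = 4 * (q * (norm x)\<^sup>2)"
    proof -
      have "(norm (x + y))\<^sup>2 + (norm (x - y))\<^sup>2 = 2 * (norm x)\<^sup>2 + 2 * (norm y)\<^sup>2"
        by (simp add: power2_norm_eq_inner inner_add_left inner_add_right inner_diff_left
            inner_diff_right inner_commute)
      then show ?thesis unfolding norm_y by (simp flip: distrib_left)
    qed
    finally show ?thesis
      using False by (simp add: power2_eq_square)
  qed
  then have "spectral_norm H \<le> q"
    unfolding spectral_norm_def by (intro onorm_bound) (simp_all add: q_def)
  then show thesis
    using that v unfolding q_def by simp
qed

text \<open>The spectral norm is Lipschitz with respect to the norm of the matrix space.\<close>

lemma borel_measurable_spectral_norm [measurable]:
  "(spectral_norm :: real^'n^'n \<Rightarrow> real) \<in> borel_measurable borel"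
proof -
  let ?c = "real CARD('n) * real CARD('n)"
  have bound: "onorm ((*v) A) \<le> ?c * norm A" for A :: "real^'n^'n"
    by (intro onorm_le_matrix_component order_trans[OF component_le_norm_cart Finite_Cartesian_Product.norm_nth_le])
  have le: "spectral_norm A - spectral_norm B \<le> ?c * norm (A - B)" for A B :: "real^'n^'n"
  proof -
    have "onorm ((*v) A) = onorm (\<lambda>x. (A - B) *v x + B *v x)"
      by (simp add: matrix_vector_mult_diff_rdistrib)
    also have "\<dots> \<le> onorm ((*v) (A - B)) + onorm ((*v) B)"
      by (intro onorm_triangle matrix_vector_mul_bounded_linear)
    finally show ?thesis
      using bound[of "A - B"] by (simp add: spectral_norm_def)
  qed
  have "?c-lipschitz_on UNIV (spectral_norm :: real^'n^'n \<Rightarrow> real)"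
  proof (rule lipschitz_onI)
    show "dist (spectral_norm A) (spectral_norm B) \<le> ?c * dist A B" for A B :: "real^'n^'n"
      using le[of A B] le[of B A] by (simp add: dist_norm norm_minus_commute abs_le_iff)
  qed simp
  then show ?thesis
    by (intro borel_measurable_continuous_onI lipschitz_on_continuous_on)
qed

lemma gamma_inverse_pos: "0 < 3/2 * ln (3/2) - (1/2 :: real)"
proof -
  have "exp (1/3) \<le> 1 + 1/3 + (1/3 :: real)\<^sup>2"
    by (rule exp_bound) simp_all
  also have "\<dots> < 3/2"
    by (simp add: power2_eq_square)
  finally have "ln (exp (1/3)) < ln (3/2 :: real)"
    by (subst ln_less_cancel_iff) simp_all
  then show ?thesis by simp
qed

text \<open>The subdivision into three parts suffices for the lower tail, with \<open>r = 1/2\<close>: the right-hand side is about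
  \<open>0.723\<close> and the left-hand side, which encodes the rate \<open>1/\<gamma> \<approx> 0.1082\<close> of the upper tail, about \<open>0.716\<close>.\<close>

lemma lower_tail_rate:
  "2 * (3/2 * ln (3/2) - 1/2) + 1/2 \<le> (\<Sum>k<3. exp (- (real (3 - k) * (1/2) / real 3))) / real 3"
proof -
  define t :: real where "t = exp (-1/6)"
  \<comment> \<open>\<open>ln (3/2) \<approx> 0.4055\<close>; the bound \<open>0.407\<close> leaves room for a quadratic Taylor polynomial at \<open>0.407 / 4\<close>\<close>
  have "(3/2 :: real) \<le> (1 + 407/4000 + (407/4000)\<^sup>2 / 2) ^ 4"
    by (simp add: power_divide eval_nat_numeral)
  also have "\<dots> \<le> exp (407/4000) ^ 4"
    by (intro power_mono exp_lower_Taylor_quadratic) simp_all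
  also have "\<dots> = exp (407/1000)"
    by (simp flip: exp_of_nat_mult)
  finally have "ln (3/2) \<le> ln (exp (407/1000 :: real))"
    by (subst ln_le_cancel_iff) simp_all
  then have ln: "ln (3/2) \<le> (407/1000 :: real)" by simp
  \<comment> \<open>\<open>exp (-1/6) \<approx> 0.84648\<close>, from \<open>1 - s \<le> exp (- s)\<close> at \<open>s = 1/96\<close>\<close>
  have "8457/10000 \<le> (95/96 :: real) ^ 16"
    by (simp add: power_divide)
  also have "\<dots> \<le> exp (-1/96) ^ 16"
    using exp_ge_add_one_self[of "-1/96"] by (intro power_mono) simp_all
  also have "\<dots> = t"
    by (simp add: t_def flip: exp_of_nat_mult)
  finally have t: "8457/10000 \<le> t" .
  have "2163/1000 \<le> (8457/10000 :: real) + (8457/10000)\<^sup>2 + (8457/10000) ^ 3"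
    by (simp add: eval_nat_numeral)
  also have "\<dots> \<le> t + t\<^sup>2 + t ^ 3"
    using t by (intro add_mono power_mono) simp_all
  also have "\<dots> = (\<Sum>k<3. exp (- (real (3 - k) * (1/2) / real 3)))"
    by (simp add: t_def eval_nat_numeral flip: exp_of_nat_mult exp_add)
  finally show ?thesis using ln by simp
qed

section \<open>Concentration of averages of rank-one matrices\<close>

text \<open>A random vector \<open>a\<close> with second-moment matrix \<open>I\<close> and with squared length at most \<open>R\<close>.\<close>

locale isotropic_sampling = prob_space \<sigma> for \<sigma> :: "'a measure" +
  fixes a :: "'a \<Rightarrow> real^'n" and R :: real
  assumes measurable_a [measurable]: "a \<in> borel_measurable \<sigma>"
    and norm_a: "\<And>y. y \<in> space \<sigma> \<Longrightarrow> (norm (a y))\<^sup>2 \<le> R"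
    and R_pos: "0 < R"
    and isotropic: "\<And>j k. (\<integral>y. a y $ j * a y $ k \<partial>\<sigma>) = (if j = k then 1 else 0)"
begin

lemma integrable_components: "integrable \<sigma> (\<lambda>y. a y $ j * a y $ k)"
proof (rule integrable_const_bound[of _ R])
  have "\<bar>a y $ j * a y $ k\<bar> \<le> R" if "y \<in> space \<sigma>" for y
  proof -
    have "\<bar>a y $ j * a y $ k\<bar> \<le> norm (a y) * norm (a y)"
      unfolding abs_mult by (intro mult_mono component_le_norm_cart) simp_all
    also have "\<dots> \<le> R"
      using norm_a[OF that] by (simp add: power2_eq_square)
    finally show ?thesis .
  qed
  then show "AE y in \<sigma>. norm (a y $ j * a y $ k) \<le> R" by simp
qed measurable

lemma integral_form:
  "integrable \<sigma> (\<lambda>y. a y \<bullet> (M *v a y))" "(\<integral>y. a y \<bullet> (M *v a y) \<partial>\<sigma>) = trace M"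
proof -
  show "integrable \<sigma> (\<lambda>y. a y \<bullet> (M *v a y))"
    unfolding form_eq_sum_entries by (intro Bochner_Integration.integrable_sum integrable_mult_left integrable_components)
  have "(\<integral>y. a y \<bullet> (M *v a y) \<partial>\<sigma>) = (\<Sum>j\<in>UNIV. \<Sum>k\<in>UNIV. (if j = k then 1 else 0) * M $ j $ k)"
    unfolding form_eq_sum_entries
    by (simp add: Bochner_Integration.integral_sum Bochner_Integration.integrable_sum integrable_components isotropic)
  then show "(\<integral>y. a y \<bullet> (M *v a y) \<partial>\<sigma>) = trace M"
    by (simp add: trace_def if_distrib[of "\<lambda>c. c * _"] cong: if_cong)
qed

text \<open>Isotropy turns the expectation of \<open>\<langle>a, exp A a\<rangle>\<close> into \<open>tr exp A\<close>, so that one sample costs a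
  factor \<open>1 + \<kappa>\<close>.\<close>

lemma trace_mexp_step:
  assumes "psd A" and le: "\<And>y. y \<in> space \<sigma> \<Longrightarrow>
    trace (mexp (A + Y y)) \<le> trace (mexp A) + \<kappa> * (a y \<bullet> (mexp A *v a y))"
    and pos: "\<And>y. y \<in> space \<sigma> \<Longrightarrow> 0 \<le> trace (mexp (A + Y y))"
  shows "(\<integral>\<^sup>+y. ennreal (trace (mexp (A + Y y))) \<partial>\<sigma>) \<le> ennreal (exp \<kappa> * trace (mexp A))"
proof -
  have "(\<integral>\<^sup>+y. ennreal (trace (mexp (A + Y y))) \<partial>\<sigma>)
      \<le> (\<integral>\<^sup>+y. ennreal (trace (mexp A) + \<kappa> * (a y \<bullet> (mexp A *v a y))) \<partial>\<sigma>)"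
    by (intro nn_integral_mono ennreal_leI le)
  also have "\<dots> = ennreal (\<integral>y. trace (mexp A) + \<kappa> * (a y \<bullet> (mexp A *v a y)) \<partial>\<sigma>)"
    using order_trans[OF pos le]
    by (intro nn_integral_eq_integral AE_I2) (simp_all add: integral_form)
  also have "(\<integral>y. trace (mexp A) + \<kappa> * (a y \<bullet> (mexp A *v a y)) \<partial>\<sigma>) = (1 + \<kappa>) * trace (mexp A)"
    by (simp add: integral_form prob_space algebra_simps)
  also have "ennreal ((1 + \<kappa>) * trace (mexp A)) \<le> ennreal (exp \<kappa> * trace (mexp A))"
    by (intro ennreal_leI mult_right_mono trace_mexp_nonneg assms exp_ge_add_one_self)
  finally show ?thesis .
qed

definition empirical :: "nat \<Rightarrow> (nat \<Rightarrow> 'a) \<Rightarrow> real^'n^'n" where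
  "empirical m x = (\<Sum>i=1..m. outer (a (x i))) /\<^sub>R real m"

lemma empirical_measurable [measurable]: "empirical m \<in> borel_measurable (\<Pi>\<^sub>M i\<in>{1..m}. \<sigma>)"
  unfolding empirical_def[abs_def] by measurable

text \<open>The Chernoff parameter \<open>\<theta> = ln (3/2) / R\<close> is the optimal one for the deviation \<open>3/2\<close>. It is chosen so that
  the scaled vectors have squared length at most \<open>r = ln (3/2)\<close>, whence \<open>e\<^sup>r - 1 = 1/2\<close>.\<close>

lemma upper_tail:
  "measure (\<Pi>\<^sub>M i\<in>{1..m}. \<sigma>) {x \<in> space (\<Pi>\<^sub>M i\<in>{1..m}. \<sigma>).
      exp (real m / R * (3/2 * ln (3/2))) \<le> trace (mexp (0 + (\<Sum>i=1..m. (ln (3/2) / R) *\<^sub>R outer (a (x i)))))}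
    \<le> real CARD('n) * exp (- (real m / R * (3/2 * ln (3/2) - 1/2)))"
proof -
  define \<theta> where "\<theta> = ln (3/2) / R"
  have \<theta>: "0 < \<theta>" "\<theta> * R = ln (3/2)"
    using R_pos by (simp_all add: \<theta>_def)
  define \<kappa> where "\<kappa> = 1 / (2 * R)"
  have "measure (\<Pi>\<^sub>M i\<in>{1..m}. \<sigma>) {x \<in> space (\<Pi>\<^sub>M i\<in>{1..m}. \<sigma>).
      exp (real m / R * (3/2 * ln (3/2))) \<le> trace (mexp (0 + (\<Sum>i=1..m. \<theta> *\<^sub>R outer (a (x i)))))}
    \<le> exp \<kappa> ^ card {1..m} * trace (mexp (0 :: real^'n^'n)) / exp (real m / R * (3/2 * ln (3/2)))"
  proof (rule iid_sum_trace_mexp_tail[where Q = "\<lambda>k A. psd A"])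
    show "psd (A + \<theta> *\<^sub>R outer (a y))" if "psd A" for A :: "real^'n^'n" and y
      using that \<theta> by (intro psd_add psd_scaleR psd_outer) simp_all
    show "(\<integral>\<^sup>+y. ennreal (trace (mexp (A + \<theta> *\<^sub>R outer (a y)))) \<partial>\<sigma>) \<le> ennreal (exp \<kappa> * trace (mexp A))"
      if "psd A" for A :: "real^'n^'n"
    proof (rule trace_mexp_step[OF that])
      fix y assume y: "y \<in> space \<sigma>"
      let ?b = "sqrt \<theta> *\<^sub>R a y"
      have "(norm ?b)\<^sup>2 \<le> ln (3/2)"
        using mult_left_mono[OF norm_a[OF y], of \<theta>] \<theta> by (simp add: power_mult_distrib)
      then have "trace (mexp (A + outer ?b))
          \<le> trace (mexp A) + (exp (ln (3/2)) - 1) / ln (3/2) * (?b \<bullet> (mexp A *v ?b))"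
        by (intro trace_mexp_rank_one_le that) simp_all
      moreover have "(exp (ln (3/2)) - 1) / ln (3/2) * (?b \<bullet> (mexp A *v ?b)) = \<kappa> * (a y \<bullet> (mexp A *v a y))"
        using \<theta>(1) R_pos by (simp add: matrix_vector_mult_scaleR \<kappa>_def \<theta>_def field_simps)
      ultimately show "trace (mexp (A + \<theta> *\<^sub>R outer (a y))) \<le> trace (mexp A) + \<kappa> * (a y \<bullet> (mexp A *v a y))"
        using \<theta>(1) by (simp add: outer_scaleR)
      show "0 \<le> trace (mexp (A + \<theta> *\<^sub>R outer (a y)))"
        using \<theta> by (intro trace_mexp_nonneg psd_add that psd_scaleR psd_outer) simp
    qed
    show "0 \<le> trace (mexp (0 :: real^'n^'n))"
      by (intro trace_mexp_nonneg psd_0)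
  qed (use psd_0 in \<open>simp_all add: prob_space_axioms\<close>)
  also have "\<dots> = real CARD('n) * exp (- (real m / R * (3/2 * ln (3/2) - 1/2)))"
    using trace_mexp_scaled_identity[where 'n = 'n, of 0] R_pos
    by (simp add: \<kappa>_def exp_diff[symmetric] field_simps flip: exp_of_nat_mult)
      (simp add: field_simps flip: exp_add)
  finally show ?thesis unfolding \<theta>_def .
qed

text \<open>Here the parameter is \<open>\<theta> = 1 / (2 R)\<close>, so \<open>r = 1/2\<close>. The sum is subtracted from \<open>(m/2) I\<close>, which provides
  one half of the identity for every sample and so keeps all partial sums positive semidefinite. The shift cancels
  between the initial trace and the threshold.\<close>

lemma lower_tail:
  "measure (\<Pi>\<^sub>M i\<in>{1..m}. \<sigma>) {x \<in> space (\<Pi>\<^sub>M i\<in>{1..m}. \<sigma>).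
      exp (real m / 2 - real m / (4 * R))
        \<le> trace (mexp ((real m / 2) *\<^sub>R mat 1 + (\<Sum>i=1..m. - ((1 / (2 * R)) *\<^sub>R outer (a (x i))))))}
    \<le> real CARD('n) * exp (- (real m / R * (3/2 * ln (3/2) - 1/2)))"
proof -
  define \<theta> where "\<theta> = 1 / (2 * R)"
  have \<theta>: "0 < \<theta>" "\<theta> * R = 1/2"
    using R_pos by (simp_all add: \<theta>_def)
  define s where "s = (\<Sum>k<3. exp (- (real (3 - k) * (1/2) / real 3))) / real 3"
  define \<kappa> where "\<kappa> = - (s * \<theta>)"
  have half_minus: "psd ((1/2) *\<^sub>R mat 1 - \<theta> *\<^sub>R outer (a y))" if "y \<in> space \<sigma>" for y
    using psd_identity_minus_outer[of "sqrt \<theta> *\<^sub>R a y" "1/2"] mult_left_mono[OF norm_a[OF that], of \<theta>] \<theta>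
    by (simp add: power_mult_distrib outer_scaleR)
  let ?Q = "\<lambda>k A :: real^'n^'n. psd (A - (real k / 2) *\<^sub>R mat 1)"
  have psd_Q: "psd A" if "?Q k A" for k A
    using psd_add[OF that psd_scaleR[OF psd_mat_1, of "real k / 2"]] by simp
  have Q_step: "?Q k (A + - (\<theta> *\<^sub>R outer (a y)))" if "?Q (Suc k) A" "y \<in> space \<sigma>" for k A y
    using psd_add[OF that(1) half_minus[OF that(2)]] by (simp add: algebra_simps add_divide_distrib)
  have "measure (\<Pi>\<^sub>M i\<in>{1..m}. \<sigma>) {x \<in> space (\<Pi>\<^sub>M i\<in>{1..m}. \<sigma>).
      exp (real m / 2 - real m / (4 * R))
        \<le> trace (mexp ((real m / 2) *\<^sub>R mat 1 + (\<Sum>i=1..m. - (\<theta> *\<^sub>R outer (a (x i))))))}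
    \<le> exp \<kappa> ^ card {1..m} * trace (mexp ((real m / 2) *\<^sub>R mat 1 :: real^'n^'n))
        / exp (real m / 2 - real m / (4 * R))"
  proof (rule iid_sum_trace_mexp_tail[where Q = ?Q])
    show "?Q k (A + - (\<theta> *\<^sub>R outer (a y)))" if "?Q (Suc k) A" "y \<in> space \<sigma>" for k A y
      using that by (rule Q_step)
    show "(\<integral>\<^sup>+y. ennreal (trace (mexp (A + - (\<theta> *\<^sub>R outer (a y))))) \<partial>\<sigma>) \<le> ennreal (exp \<kappa> * trace (mexp A))"
      if Q: "?Q (Suc k) A" for k and A :: "real^'n^'n"
    proof (rule trace_mexp_step[OF psd_Q[OF Q]])
      fix y assume y: "y \<in> space \<sigma>"
      let ?b = "sqrt \<theta> *\<^sub>R a y" and ?C = "A + - (\<theta> *\<^sub>R outer (a y))"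
      have C: "psd ?C"
        by (rule psd_Q[OF Q_step[OF Q y]])
      have A: "?C + outer ?b = A"
        using \<theta> by (simp add: outer_scaleR)
      have "(norm ?b)\<^sup>2 \<le> 1/2"
        using mult_left_mono[OF norm_a[OF y], of \<theta>] \<theta> by (simp add: power_mult_distrib)
      then have "trace (mexp ?C) + s * (?b \<bullet> (mexp A *v ?b)) \<le> trace (mexp A)"
        using trace_mexp_rank_one_subdivided[OF C, of ?b "1/2" 3] unfolding A s_def by simp
      moreover have "s * (?b \<bullet> (mexp A *v ?b)) = - (\<kappa> * (a y \<bullet> (mexp A *v a y)))"
        using \<theta>(1) by (simp add: matrix_vector_mult_scaleR \<kappa>_def)
      ultimately show "trace (mexp ?C) \<le> trace (mexp A) + \<kappa> * (a y \<bullet> (mexp A *v a y))"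
        by simp
      show "0 \<le> trace (mexp ?C)"
        by (rule trace_mexp_nonneg[OF C])
    qed
    show "0 \<le> trace (mexp ((real m / 2) *\<^sub>R mat 1 :: real^'n^'n))"
      by (intro trace_mexp_nonneg psd_scaleR psd_mat_1) simp
  qed (use psd_0 in \<open>simp_all add: prob_space_axioms\<close>)
  also have "\<dots> = real CARD('n) * exp (real m * \<kappa> + real m / (4 * R))"
  proof -
    have "exp \<kappa> ^ m * exp (real m / 2) / exp (real m / 2 - real m / (4 * R)) = exp (real m * \<kappa> + real m / (4 * R))"
      by (simp flip: exp_of_nat_mult exp_add exp_diff)
    from this[symmetric] show ?thesis
      by (simp add: trace_mexp_scaled_identity)
  qed
  also have "\<dots> \<le> real CARD('n) * exp (- (real m / R * (3/2 * ln (3/2) - 1/2)))"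
  proof -
    have "(real m / (2 * R)) * (2 * (3/2 * ln (3/2) - 1/2) + 1/2) \<le> (real m / (2 * R)) * s"
      using lower_tail_rate R_pos unfolding s_def by (intro mult_left_mono) simp_all
    then show ?thesis
      by (simp add: \<kappa>_def \<theta>_def algebra_simps)
  qed
  finally show ?thesis unfolding \<theta>_def .
qed

text \<open>A deviation of spectral norm at least \<open>1/2\<close> has a unit vector \<open>v\<close> with \<open>\<langle>v, G v\<rangle> \<ge> 3/2\<close> or
  \<open>\<langle>v, G v\<rangle> \<le> 1/2\<close>; through \<open>exp_form_le_trace_mexp\<close> these cases lead to the two tails.\<close>

theorem empirical_deviation:
  assumes "0 < m"
  shows "measure (\<Pi>\<^sub>M i\<in>{1..m}. \<sigma>)
      {x \<in> space (\<Pi>\<^sub>M i\<in>{1..m}. \<sigma>). 1/2 \<le> spectral_norm (empirical m x - mat 1)}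
    \<le> 2 * real CARD('n) * exp (- (real m / R * (3/2 * ln (3/2) - 1/2)))"
proof -
  let ?P = "\<Pi>\<^sub>M i\<in>{1..m}. \<sigma>"
  interpret P: prob_space ?P
    by (intro prob_space_PiM prob_space_axioms)
  let ?U = "{x \<in> space ?P. exp (real m / R * (3/2 * ln (3/2)))
    \<le> trace (mexp (0 + (\<Sum>i=1..m. (ln (3/2) / R) *\<^sub>R outer (a (x i)))))}"
  let ?L = "{x \<in> space ?P. exp (real m / 2 - real m / (4 * R))
    \<le> trace (mexp ((real m / 2) *\<^sub>R mat 1 + (\<Sum>i=1..m. - ((1 / (2 * R)) *\<^sub>R outer (a (x i))))))}"
  have [measurable]: "?U \<in> sets ?P" "?L \<in> sets ?P" by measurable
  have "{x \<in> space ?P. 1/2 \<le> spectral_norm (empirical m x - mat 1)} \<subseteq> ?U \<union> ?L"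
  proof safe
    fix x assume x: "x \<in> space ?P" and dev: "1/2 \<le> spectral_norm (empirical m x - mat 1)"
      and not_low: "\<not> exp (real m / 2 - real m / (4 * R))
        \<le> trace (mexp ((real m / 2) *\<^sub>R mat 1 + (\<Sum>i=1..m. - ((1 / (2 * R)) *\<^sub>R outer (a (x i))))))"
    have space: "x i \<in> space \<sigma>" if "i \<in> {1..m}" for i
      using x that by (auto simp: space_PiM)
    have sum: "(\<Sum>i=1..m. outer (a (x i))) = real m *\<^sub>R empirical m x"
      using assms by (simp add: empirical_def)
    have psd_emp: "psd (empirical m x)"
      unfolding empirical_def by (intro psd_scaleR psd_sum psd_outer) simp
    obtain v where v: "norm v = 1" and "1/2 \<le> \<bar>v \<bullet> ((empirical m x - mat 1) *v v)\<bar>"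
    proof (rule spectral_norm_le_form[of "empirical m x - mat 1"])
      show "y \<bullet> ((empirical m x - mat 1) *v z) = ((empirical m x - mat 1) *v y) \<bullet> z" for y z
        using psd_self_adjoint[OF psd_emp]
        by (simp add: matrix_vector_mult_diff_rdistrib inner_diff_left inner_diff_right)
    qed (use dev that in fastforce)
    then consider "3/2 \<le> v \<bullet> (empirical m x *v v)" | "v \<bullet> (empirical m x *v v) \<le> 1/2"
    proof -
      have "v \<bullet> ((empirical m x - mat 1) *v v) = v \<bullet> (empirical m x *v v) - 1"
        using v by (simp add: matrix_vector_mult_diff_rdistrib inner_diff_right dot_square_norm)
      then have "3/2 \<le> v \<bullet> (empirical m x *v v) \<or> v \<bullet> (empirical m x *v v) \<le> 1/2"
        using \<open>1/2 \<le> \<bar>v \<bullet> ((empirical m x - mat 1) *v v)\<bar>\<close> by linarith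
      then show thesis using that by blast
    qed
    then show "exp (real m / R * (3/2 * ln (3/2)))
        \<le> trace (mexp (0 + (\<Sum>i=1..m. (ln (3/2) / R) *\<^sub>R outer (a (x i)))))"
    proof cases
      case 1
      let ?A = "\<Sum>i=1..m. (ln (3/2) / R) *\<^sub>R outer (a (x i))"
      have "v \<bullet> (?A *v v) = ln (3/2) / R * real m * (v \<bullet> (empirical m x *v v))"
        by (simp add: sum[unfolded One_nat_def] flip: scaleR_sum_right scaleR_matrix_vector_assoc)
      moreover have "ln (3/2) / R * real m * (3/2) \<le> ln (3/2) / R * real m * (v \<bullet> (empirical m x *v v))"
        using 1 R_pos by (intro mult_left_mono) simp_all
      ultimately have "exp (real m / R * (3/2 * ln (3/2))) \<le> exp (v \<bullet> (?A *v v))"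
        by (simp add: mult_ac)
      also have "\<dots> \<le> trace (mexp ?A)"
        using R_pos v by (intro exp_form_le_trace_mexp psd_sum psd_scaleR psd_outer) simp_all
      finally show ?thesis by simp
    next
      case 2
      let ?A = "(real m / 2) *\<^sub>R mat 1 + (\<Sum>i=1..m. - ((1 / (2 * R)) *\<^sub>R outer (a (x i))))"
      have A: "?A = (\<Sum>i=1..m. (1/2) *\<^sub>R mat 1 - (1 / (2 * R)) *\<^sub>R outer (a (x i)))"
        by (simp add: sum_subtractf sum_negf sum_constant_scaleR del: sum_constant)
      have "psd ?A"
        unfolding A
      proof (rule psd_sum)
        fix i assume i: "i \<in> {1..m}"
        show "psd ((1/2) *\<^sub>R mat 1 - (1 / (2 * R)) *\<^sub>R outer (a (x i)))"
          using psd_identity_minus_outer[of "sqrt (1 / (2 * R)) *\<^sub>R a (x i)" "1/2"]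
            mult_left_mono[OF norm_a[OF space[OF i]], of "1 / (2 * R)"] R_pos
          by (simp add: power_mult_distrib outer_scaleR)
      qed
      have "?A *v v = (real m / 2) *\<^sub>R v - (real m / (2 * R)) *\<^sub>R (empirical m x *v v)"
        using R_pos
        by (simp add: sum_negf sum[unfolded One_nat_def] matrix_vector_mult_diff_rdistrib flip: scaleR_sum_right scaleR_matrix_vector_assoc)
      then have "v \<bullet> (?A *v v) = real m / 2 - real m / (2 * R) * (v \<bullet> (empirical m x *v v))"
        using v by (simp add: inner_diff_right dot_square_norm)
      moreover have "real m / (2 * R) * (v \<bullet> (empirical m x *v v)) \<le> real m / (2 * R) * (1/2)"
        using 2 R_pos by (intro mult_left_mono) simp_all
      ultimately have "exp (real m / 2 - real m / (4 * R)) \<le> exp (v \<bullet> (?A *v v))"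
        by simp
      also have "\<dots> \<le> trace (mexp ?A)"
        by (rule exp_form_le_trace_mexp[OF \<open>psd ?A\<close> v])
      finally show ?thesis using not_low by simp
    qed
  qed
  then have "measure ?P {x \<in> space ?P. 1/2 \<le> spectral_norm (empirical m x - mat 1)} \<le> measure ?P (?U \<union> ?L)"
    by (intro P.finite_measure_mono) measurable
  also have "\<dots> \<le> measure ?P ?U + measure ?P ?L"
    by (intro measure_Un_le) measurable
  also have "\<dots> \<le> 2 * real CARD('n) * exp (- (real m / R * (3/2 * ln (3/2) - 1/2)))"
    using upper_tail[of m] lower_tail[of m] by linarith
  finally show ?thesis .
qed

end

section \<open>Second moments of averages of independent vectors\<close>

lemma expectation_square_iid_sum:
  fixes \<xi> :: "'a \<Rightarrow> real"
  assumes \<sigma>: "prob_space \<sigma>" and int: "integrable \<sigma> \<xi>" and int2: "integrable \<sigma> (\<lambda>y. (\<xi> y)\<^sup>2)"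
    and centred: "(\<integral>y. \<xi> y \<partial>\<sigma>) = 0" and I: "finite I"
  shows "integrable (\<Pi>\<^sub>M i\<in>I. \<sigma>) (\<lambda>x. (\<Sum>i\<in>I. \<xi> (x i))\<^sup>2)"
    and "(\<integral>x. (\<Sum>i\<in>I. \<xi> (x i))\<^sup>2 \<partial>(\<Pi>\<^sub>M i\<in>I. \<sigma>)) = real (card I) * (\<integral>y. (\<xi> y)\<^sup>2 \<partial>\<sigma>)"
proof -
  interpret prob_space \<sigma> by fact
  interpret product_sigma_finite "\<lambda>_. \<sigma>" ..
  let ?P = "\<Pi>\<^sub>M i\<in>I. \<sigma>"
  \<comment> \<open>\<open>\<xi> (x i) * \<xi> (x k)\<close> as a product over all coordinates, so that Fubini applies for \<open>i = k\<close> and \<open>i \<noteq> k\<close> alike\<close>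
  let ?f = "\<lambda>i k j y. (if j = i then \<xi> y else 1) * (if j = k then \<xi> y else 1)"
  have f_int: "integrable \<sigma> (?f i k j)" for i k j
    using int int2 by (cases "j = i"; cases "j = k") (simp_all add: power2_eq_square)
  have prod: "(\<Prod>j\<in>I. ?f i k j (x j)) = \<xi> (x i) * \<xi> (x k)" if "i \<in> I" "k \<in> I" for i k x
    using I that by (simp add: prod.distrib prod.delta)
  have pair_int: "integrable ?P (\<lambda>x. \<xi> (x i) * \<xi> (x k))" if "i \<in> I" "k \<in> I" for i k
    unfolding prod[OF that, symmetric] by (intro product_integrable_prod I f_int)
  have pair: "(\<integral>x. \<xi> (x i) * \<xi> (x k) \<partial>?P) = (if i = k then \<integral>y. (\<xi> y)\<^sup>2 \<partial>\<sigma> else 0)"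
    if "i \<in> I" "k \<in> I" for i k
  proof -
    have "(\<integral>x. \<xi> (x i) * \<xi> (x k) \<partial>?P) = (\<Prod>j\<in>I. \<integral>y. ?f i k j y \<partial>\<sigma>)"
      unfolding prod[OF that, symmetric] by (intro product_integral_prod I f_int)
    also have "\<dots> = (if i = k then \<integral>y. (\<xi> y)\<^sup>2 \<partial>\<sigma> else 0)"
    proof (cases "i = k")
      case True
      then have "(\<integral>y. ?f i k j y \<partial>\<sigma>) = (if j = i then \<integral>y. (\<xi> y)\<^sup>2 \<partial>\<sigma> else 1)" for j
        by (simp add: power2_eq_square prob_space)
      then show ?thesis
        using True I that by (simp add: prod.delta)
    next
      case False
      then have "(\<integral>y. ?f i k i y \<partial>\<sigma>) = 0"
        using centred by simp
      then have "\<exists>j\<in>I. (\<integral>y. ?f i k j y \<partial>\<sigma>) = 0"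
        using that(1) by blast
      from prod_zero[OF I this] show ?thesis
        using False by simp
    qed
    finally show ?thesis .
  qed
  have square: "(\<Sum>i\<in>I. \<xi> (x i))\<^sup>2 = (\<Sum>i\<in>I. \<Sum>k\<in>I. \<xi> (x i) * \<xi> (x k))" for x
    by (simp add: power2_eq_square sum_product)
  show "integrable ?P (\<lambda>x. (\<Sum>i\<in>I. \<xi> (x i))\<^sup>2)"
    unfolding square by (intro Bochner_Integration.integrable_sum pair_int)
  have "(\<integral>x. (\<Sum>i\<in>I. \<xi> (x i))\<^sup>2 \<partial>?P) = (\<Sum>i\<in>I. \<Sum>k\<in>I. \<integral>x. \<xi> (x i) * \<xi> (x k) \<partial>?P)"
    unfolding square
    by (simp add: Bochner_Integration.integral_sum Bochner_Integration.integrable_sum pair_int)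
  also have "\<dots> = (\<Sum>i\<in>I. \<Sum>k\<in>I. if i = k then \<integral>y. (\<xi> y)\<^sup>2 \<partial>\<sigma> else 0)"
    by (intro sum.cong refl pair)
  also have "\<dots> = real (card I) * (\<integral>y. (\<xi> y)\<^sup>2 \<partial>\<sigma>)"
    using I by simp
  finally show "(\<integral>x. (\<Sum>i\<in>I. \<xi> (x i))\<^sup>2 \<partial>?P) = real (card I) * (\<integral>y. (\<xi> y)\<^sup>2 \<partial>\<sigma>)" .
qed

context isotropic_sampling
begin

definition empirical_noise :: "('a \<Rightarrow> real) \<Rightarrow> nat \<Rightarrow> (nat \<Rightarrow> 'a) \<Rightarrow> real^'n" where
  "empirical_noise h m x = (\<Sum>i=1..m. h (x i) *\<^sub>R a (x i)) /\<^sub>R real m"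

lemma expectation_empirical_noise:
  assumes h [measurable]: "h \<in> borel_measurable \<sigma>" and h2: "integrable \<sigma> (\<lambda>y. (h y)\<^sup>2)"
    and orth: "\<And>j. (\<integral>y. h y * a y $ j \<partial>\<sigma>) = 0" and "0 < m"
  shows "integrable (\<Pi>\<^sub>M i\<in>{1..m}. \<sigma>) (\<lambda>x. (norm (empirical_noise h m x))\<^sup>2)"
    and "(\<integral>x. (norm (empirical_noise h m x))\<^sup>2 \<partial>(\<Pi>\<^sub>M i\<in>{1..m}. \<sigma>)) \<le> R / real m * (\<integral>y. (h y)\<^sup>2 \<partial>\<sigma>)"
proof -
  let ?P = "\<Pi>\<^sub>M i\<in>{1..m}. \<sigma>"
  let ?\<xi> = "\<lambda>j y. h y * a y $ j"
  have bound: "(\<Sum>j\<in>UNIV. (?\<xi> j y)\<^sup>2) \<le> R * (h y)\<^sup>2" if "y \<in> space \<sigma>" for y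
  proof -
    have "(\<Sum>j\<in>UNIV. (?\<xi> j y)\<^sup>2) = (norm (a y))\<^sup>2 * (h y)\<^sup>2"
      unfolding power2_norm_eq_inner
      by (simp add: inner_vec_def power_mult_distrib sum_distrib_left sum_distrib_right power2_eq_square mult_ac)
    then show ?thesis
      using norm_a[OF that] by (simp add: mult_right_mono)
  qed
  have int2: "integrable \<sigma> (\<lambda>y. (?\<xi> j y)\<^sup>2)" for j
  proof (rule Bochner_Integration.integrable_bound)
    show "integrable \<sigma> (\<lambda>y. R * (h y)\<^sup>2)" using h2 by simp
    have "(?\<xi> j y)\<^sup>2 \<le> R * (h y)\<^sup>2" if "y \<in> space \<sigma>" for y
      using bound[OF that] member_le_sum[of j UNIV "\<lambda>j. (?\<xi> j y)\<^sup>2"] by simp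
    then show "AE y in \<sigma>. norm ((?\<xi> j y)\<^sup>2) \<le> norm (R * (h y)\<^sup>2)"
      using R_pos by (intro AE_I2) simp
  qed measurable
  have int: "integrable \<sigma> (?\<xi> j)" for j
    by (rule square_integrable_imp_integrable) (use int2 in simp_all)
  have norm_eq: "(norm (empirical_noise h m x))\<^sup>2 = (\<Sum>j\<in>UNIV. (\<Sum>i=1..m. ?\<xi> j (x i))\<^sup>2) / (real m)\<^sup>2" for x
    unfolding power2_norm_eq_inner
    by (simp add: empirical_noise_def inner_vec_def power2_eq_square sum_divide_distrib divide_inverse
        sum_distrib_left mult_ac)
  note square = expectation_square_iid_sum[OF prob_space_axioms int int2 orth finite_atLeastAtMost]
  show "integrable ?P (\<lambda>x. (norm (empirical_noise h m x))\<^sup>2)"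
    unfolding norm_eq by (intro integrable_divide Bochner_Integration.integrable_sum square)
  have "(\<integral>x. (norm (empirical_noise h m x))\<^sup>2 \<partial>?P) = (\<Sum>j\<in>UNIV. real m * (\<integral>y. (?\<xi> j y)\<^sup>2 \<partial>\<sigma>)) / (real m)\<^sup>2"
    unfolding norm_eq by (simp add: Bochner_Integration.integral_sum square)
  also have "\<dots> = (\<integral>y. (\<Sum>j\<in>UNIV. (?\<xi> j y)\<^sup>2) \<partial>\<sigma>) / real m"
    using \<open>0 < m\<close> int2
    by (simp add: Bochner_Integration.integral_sum power2_eq_square flip: sum_distrib_left)
  also have "\<dots> \<le> (\<integral>y. R * (h y)\<^sup>2 \<partial>\<sigma>) / real m"
    using h2 int2 bound by (intro divide_right_mono integral_mono Bochner_Integration.integrable_sum) simp_all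
  finally show "(\<integral>x. (norm (empirical_noise h m x))\<^sup>2 \<partial>?P) \<le> R / real m * (\<integral>y. (h y)\<^sup>2 \<partial>\<sigma>)"
    by simp
qed

end

section \<open>Stable linear systems and square-integrable functions\<close>

lemma norm_le_of_spectral_norm_le_half:
  fixes G :: "real^'n^'n"
  assumes "spectral_norm (G - mat 1) \<le> 1/2"
  shows "norm d \<le> 2 * norm (G *v d)"
proof -
  have "norm ((G - mat 1) *v d) \<le> spectral_norm (G - mat 1) * norm d"
    unfolding spectral_norm_def by (rule onorm) (rule matrix_vector_mul_bounded_linear)
  also have "\<dots> \<le> 1/2 * norm d"
    using assms by (intro mult_right_mono) simp_all
  finally have "norm (G *v d - d) \<le> 1/2 * norm d"
    by (simp add: matrix_vector_mult_diff_rdistrib)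
  then show ?thesis
    using norm_triangle_ineq2[of d "G *v d"] by (simp add: norm_minus_commute)
qed

lemma borel_measurable_det [measurable]: "(det :: real^'n^'n \<Rightarrow> real) \<in> borel_measurable borel"
  unfolding det_def[abs_def]
  by (intro borel_measurable_continuous_onI continuous_on_sum continuous_on_mult continuous_on_const
      continuous_on_prod continuous_on_component continuous_on_id)

lemma borel_measurable_matrix_entry [measurable (raw)]:
  assumes "F \<in> borel_measurable M"
  shows "(\<lambda>x. (F x :: real^'n^'m) $ i $ j) \<in> borel_measurable M"
proof -
  have "(\<lambda>A :: real^'n^'m. A $ i $ j) \<in> borel_measurable borel"
    by (intro borel_measurable_continuous_onI continuous_intros)
  then show ?thesis using assms by measurable
qed

text \<open>Cramer's rule gives the solution as a measurable function of the data. It is used because a minimiser of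
  the least-squares functional is an arbitrary selection, which is measurable only where it is unique.\<close>

lemma borel_measurable_linear_solve:
  fixes G :: "'a \<Rightarrow> real^'n^'n"
  assumes [measurable]: "G \<in> borel_measurable M" "b \<in> borel_measurable M"
  shows "\<exists>d \<in> borel_measurable M. \<forall>x z. det (G x) \<noteq> 0 \<longrightarrow> G x *v z = b x \<longrightarrow> z = d x"
proof -
  define d where "d x = (\<chi> k. det (\<chi> i j. if j = k then b x $ i else G x $ i $ j) / det (G x))" for x
  have "(\<lambda>x. (\<chi> i j. if j = k then b x $ i else G x $ i $ j)) \<in> borel_measurable M" for k
    by (rule borel_measurable_matrix) (auto split: if_split)
  then have "(\<lambda>x. d x $ k) \<in> borel_measurable M" for k
    unfolding d_def by simp
  then have "d \<in> borel_measurable M"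
    unfolding borel_measurable_euclidean_space[of d] by (auto simp: Basis_vec_def inner_axis)
  moreover have "z = d x" if "det (G x) \<noteq> 0" "G x *v z = b x" for x z
    using cramer[OF that(1), of z "b x"] that(2) by (simp add: d_def)
  ultimately show ?thesis by blast
qed

lemma L2_mult_integrable:
  assumes "f \<in> L2 \<mu>" and "g \<in> L2 \<mu>"
  shows "integrable \<mu> (\<lambda>x. f x * g x)"
proof (rule Bochner_Integration.integrable_bound)
  have [measurable]: "f \<in> borel_measurable \<mu>" "g \<in> borel_measurable \<mu>"
    using assms by (auto simp: L2_def)
  show "integrable \<mu> (\<lambda>x. (f x)\<^sup>2 + (g x)\<^sup>2)"
    using assms by (auto simp: L2_def)
  show "(\<lambda>x. f x * g x) \<in> borel_measurable \<mu>" by measurable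
  have "\<bar>s * t\<bar> \<le> s\<^sup>2 + t\<^sup>2" for s t :: real
  proof -
    have "2 * \<bar>s * t\<bar> \<le> s\<^sup>2 + t\<^sup>2"
      using sum_squares_bound[of "\<bar>s\<bar>" "\<bar>t\<bar>"] by (simp add: abs_mult)
    then show ?thesis by linarith
  qed
  then show "AE x in \<mu>. norm (f x * g x) \<le> norm ((f x)\<^sup>2 + (g x)\<^sup>2)"
    by (intro AE_I2) simp
qed

lemma L2_cmult: "f \<in> L2 \<mu> \<Longrightarrow> (\<lambda>x. r * f x) \<in> L2 \<mu>"
  by (auto simp: L2_def power_mult_distrib)

lemma L2_add:
  assumes "f \<in> L2 \<mu>" and "g \<in> L2 \<mu>"
  shows "(\<lambda>x. f x + g x) \<in> L2 \<mu>"
proof -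
  have "integrable \<mu> (\<lambda>x. (f x)\<^sup>2 + (g x)\<^sup>2 + 2 * (f x * g x))"
    using assms L2_mult_integrable[OF assms] by (auto simp: L2_def)
  then show ?thesis
    using assms by (auto simp: L2_def power2_sum mult.assoc)
qed

lemma L2_sum:
  assumes "\<And>j. j \<in> J \<Longrightarrow> f j \<in> L2 \<mu>"
  shows "(\<lambda>x. \<Sum>j\<in>J. f j x) \<in> L2 \<mu>"
  using assms
proof (induction J rule: infinite_finite_induct)
  case (insert j J)
  then show ?case using L2_add[of "f j" \<mu> "\<lambda>x. \<Sum>j\<in>J. f j x"] by simp
qed (simp_all add: L2_def)

lemma L2_norm_power2: "(L2_norm \<mu> f)\<^sup>2 = (\<integral>x. (f x)\<^sup>2 \<partial>\<mu>)"
  by (simp add: L2_norm_def L2_inner_def power2_eq_square)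

definition combination :: "('n::finite \<Rightarrow> 'a \<Rightarrow> real) \<Rightarrow> real^'n \<Rightarrow> 'a \<Rightarrow> real" where
  "combination L c = (\<lambda>y. \<Sum>j\<in>UNIV. c $ j * L j y)"

lemma span_range_combination:
  assumes "v \<in> fun_vs.span (range L)"
  obtains c :: "real^'n::finite" where "v = combination L c"
proof -
  have "\<exists>c :: real^'n. v = combination L c"
    using assms
  proof (induction rule: fun_vs.span_induct_alt)
    case base
    have "0 = combination L 0" by (simp add: combination_def fun_eq_iff)
    then show ?case by blast
  next
    case (step r f g)
    then obtain i c where f: "f = L i" and g: "g = combination L c" by blast
    have "fscale r f + g = combination L (c + axis i r)"
      unfolding f g combination_def fscale_def fun_eq_iff
      by (simp add: distrib_right sum.distrib axis_def if_distrib[of "\<lambda>t. t * _"] cong: if_cong)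
    then show ?case by blast
  qed
  then show thesis using that by blast
qed

text \<open>The functional does not decrease along the line \<open>s + t f\<close>, which forces its linear coefficient to vanish.\<close>

lemma wls_normal_equation:
  assumes sol: "is_wls_solution V w m x u s" and V: "fun_vs.subspace V" and "f \<in> V"
    and w: "\<And>i. i \<in> {1..m} \<Longrightarrow> 0 \<le> w (x i)"
  shows "(\<Sum>i=1..m. w (x i) * (u (x i) - s (x i)) * f (x i)) = 0"
proof -
  define S where "S = (\<Sum>i=1..m. w (x i) * (u (x i) - s (x i)) * f (x i))"
  define Q where "Q = (\<Sum>i=1..m. w (x i) * (f (x i))\<^sup>2)"
  have Q: "0 \<le> Q" unfolding Q_def using w by (intro sum_nonneg) simp
  let ?J = "\<lambda>v. \<Sum>i=1..m. w (x i) * \<bar>u (x i) - v (x i)\<bar>\<^sup>2"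
  \<comment> \<open>\<open>S / Q\<close> would be the minimum of the parabola; \<open>Q + 1\<close> avoids the case \<open>Q = 0\<close>\<close>
  define t where "t = S / (Q + 1)"
  have "s + fscale t f \<in> V"
    using sol V \<open>f \<in> V\<close> unfolding is_wls_solution_def is_arg_min_def
    by (intro fun_vs.subspace_add fun_vs.subspace_scale) simp_all
  then have "?J s \<le> ?J (s + fscale t f)"
    using sol unfolding is_wls_solution_def is_arg_min_def by (meson not_le)
  also have "?J (s + fscale t f) = ?J s - 2 * t * S + t\<^sup>2 * Q"
    unfolding S_def Q_def sum_distrib_left sum_subtractf[symmetric] sum.distrib[symmetric]
    by (intro sum.cong refl) (simp add: fscale_def power2_eq_square algebra_simps)
  finally have "2 * t * S \<le> t\<^sup>2 * Q" by simp
  moreover have "2 * t * S = 2 * (Q + 1) * t\<^sup>2"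
  proof -
    have "S = t * (Q + 1)" using Q by (simp add: t_def)
    then show ?thesis by (simp add: power2_eq_square)
  qed
  ultimately have "(Q + 2) * t\<^sup>2 \<le> 0" by (simp add: algebra_simps)
  then have "t = 0"
    using Q by (simp add: mult_le_0_iff)
  then show ?thesis
    using Q by (simp add: t_def S_def)
qed

section \<open>Weighted least squares with a dominating sampling density\<close>

lemma abs_truncate_le: "0 \<le> \<tau> \<Longrightarrow> \<bar>truncate \<tau> y\<bar> \<le> \<tau>"
  by (auto simp: truncate_def abs_mult sgn_if)

lemma truncate_contracts: "\<bar>t\<bar> \<le> \<tau> \<Longrightarrow> \<bar>t - truncate \<tau> y\<bar> \<le> \<bar>t - y\<bar>"
  by (auto simp: truncate_def sgn_if min_def)

lemma borel_measurable_truncate [measurable (raw)]: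
  assumes [measurable]: "f \<in> borel_measurable M"
  shows "(\<lambda>y. truncate \<tau> (f y)) \<in> borel_measurable M"
  unfolding truncate_def sgn_if by measurable

text \<open>Sampling from a density \<open>\<rho>\<close> with weights \<open>1/\<rho>\<close>. The constant \<open>R\<close> bounds the weighted inverse Christoffel
  function; it equals the dimension for the optimal density \<open>k\<^sub>n / n\<close>, and \<open>c\<close> times the dimension
  for the perturbed one.\<close>

locale christoffel_sampling = prob_space \<mu> for \<mu> :: "'a measure" +
  fixes V :: "('a \<Rightarrow> real) set" and L :: "'n::finite \<Rightarrow> 'a \<Rightarrow> real"
    and \<rho> :: "'a \<Rightarrow> real" and R :: real
  assumes V_L2: "V \<subseteq> L2 \<mu>"
    and basis: "orthonormal_basis (L2_inner \<mu>) V L"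
    and measurable_\<rho> [measurable]: "\<rho> \<in> borel_measurable \<mu>"
    and \<rho>_nonneg: "\<And>y. 0 \<le> \<rho> y"
    and prob_space_density: "prob_space (density \<mu> (\<lambda>y. ennreal (\<rho> y)))"
    and R_pos: "0 < R"
    and christoffel_le: "\<And>y. y \<in> space \<mu> \<Longrightarrow> inv_christoffel L y \<le> R * \<rho> y"
begin

definition \<sigma> :: "'a measure" where
  "\<sigma> = density \<mu> (\<lambda>y. ennreal (\<rho> y))"

definition w :: "'a \<Rightarrow> real" where
  "w y = inverse (\<rho> y)"

definition feature :: "'a \<Rightarrow> real^'n" where
  "feature y = (\<chi> j. sqrt (w y) * L j y)"

lemma sets_\<sigma> [measurable_cong, simp]: "sets \<sigma> = sets \<mu>" and space_\<sigma> [simp]: "space \<sigma> = space \<mu>"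
  by (simp_all add: \<sigma>_def)

lemma w_nonneg [simp]: "0 \<le> w y"
  by (simp add: w_def \<rho>_nonneg)

lemma sqrt_w [simp]: "sqrt (w y) * sqrt (w y) = w y"
  using w_nonneg by simp

lemma sqrt_w_mult [simp]: "sqrt (w y) * (sqrt (w y) * t) = w y * t"
  by (simp flip: mult.assoc)

lemma measurable_w [measurable]: "w \<in> borel_measurable \<mu>"
  unfolding w_def[abs_def] by measurable

lemma span_L: "fun_vs.span (range L) = V"
  and inner_L: "L2_inner \<mu> (L j) (L k) = (if j = k then 1 else 0)"
  using basis by (simp_all add: orthonormal_basis_def)

lemma subspace_V: "fun_vs.subspace V"
  unfolding span_L[symmetric] by (rule fun_vs.subspace_span)

lemma L_in_V: "L j \<in> V"
  unfolding span_L[symmetric] by (intro fun_vs.span_base) simp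

lemma L_in_L2: "L j \<in> L2 \<mu>"
  using L_in_V V_L2 by blast

lemma measurable_L [measurable]: "L j \<in> borel_measurable \<mu>"
  using L_in_L2[of j] by (simp add: L2_def)

lemma L_eq_0_of_density_eq_0:
  assumes "y \<in> space \<mu>" and "\<rho> y = 0"
  shows "L j y = 0"
proof -
  have "\<bar>L j y\<bar>\<^sup>2 \<le> inv_christoffel L y"
    unfolding inv_christoffel_def by (rule member_le_sum) simp_all
  also have "\<dots> \<le> 0"
    using christoffel_le[OF assms(1)] assms(2) by simp
  finally show ?thesis by simp
qed

text \<open>Where the density vanishes, the weight is \<open>0\<close> instead of its reciprocal. This does no harm, because
  all basis functions vanish there.\<close>

lemma density_weight_L: "y \<in> space \<mu> \<Longrightarrow> \<rho> y * (w y * L j y) = L j y"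
  using L_eq_0_of_density_eq_0[of y j] by (cases "\<rho> y = 0") (simp_all add: w_def)

lemma integral_\<sigma>:
  fixes f :: "'a \<Rightarrow> real"
  assumes "f \<in> borel_measurable \<mu>"
  shows "(\<integral>y. f y \<partial>\<sigma>) = (\<integral>y. \<rho> y * f y \<partial>\<mu>)" "integrable \<sigma> f \<longleftrightarrow> integrable \<mu> (\<lambda>y. \<rho> y * f y)"
  using assms \<rho>_nonneg by (simp_all add: \<sigma>_def integral_density integrable_density)

sublocale features: isotropic_sampling \<sigma> feature R
proof (intro isotropic_sampling.intro isotropic_sampling_axioms.intro)
  show "prob_space \<sigma>"
    unfolding \<sigma>_def by (rule prob_space_density)
  show "feature \<in> borel_measurable \<sigma>"
    unfolding borel_measurable_euclidean_space[of feature]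
    by (auto simp: Basis_vec_def inner_axis feature_def)
  show "(norm (feature y))\<^sup>2 \<le> R" if "y \<in> space \<sigma>" for y
  proof -
    have "(norm (feature y))\<^sup>2 = w y * inv_christoffel L y"
      unfolding power2_norm_eq_inner
      by (simp add: feature_def inner_vec_def inv_christoffel_def sum_distrib_left power2_eq_square
          mult_ac)
    also have "\<dots> \<le> w y * (R * \<rho> y)"
      using that by (intro mult_left_mono christoffel_le w_nonneg) simp
    also have "\<dots> \<le> R"
      using R_pos by (cases "\<rho> y = 0") (simp_all add: w_def)
    finally show ?thesis .
  qed
  show "0 < R" by (rule R_pos)
  show "(\<integral>y. feature y $ j * feature y $ k \<partial>\<sigma>) = (if j = k then 1 else 0)" for j k
  proof -
    have "(\<integral>y. feature y $ j * feature y $ k \<partial>\<sigma>) = (\<integral>y. w y * L j y * L k y \<partial>\<sigma>)"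
      by (simp add: feature_def mult_ac)
    also have "\<dots> = (\<integral>y. \<rho> y * (w y * L j y * L k y) \<partial>\<mu>)"
      by (intro integral_\<sigma>) measurable
    also have "\<dots> = L2_inner \<mu> (L j) (L k)"
      unfolding L2_inner_def
    proof (intro Bochner_Integration.integral_cong refl)
      fix y assume "y \<in> space \<mu>"
      then show "\<rho> y * (w y * L j y * L k y) = L j y * L k y"
        using density_weight_L[of y j] by (metis mult.assoc)
    qed
    finally show ?thesis by (simp add: inner_L)
  qed
qed

lemma gram_eq_empirical: "gram w m x L = features.empirical m x"
  by (simp add: gram_def weighted_inner_def features.empirical_def vec_eq_iff outer_def feature_def
      divide_inverse mult_ac)

definition projection :: "('a \<Rightarrow> real) \<Rightarrow> real^'n" where
  "projection u = (\<chi> j. L2_inner \<mu> u (L j))"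

definition residual :: "('a \<Rightarrow> real) \<Rightarrow> 'a \<Rightarrow> real" where
  "residual u = (\<lambda>y. u y - combination L (projection u) y)"

lemma combination_L2: "combination L c \<in> L2 \<mu>"
  unfolding combination_def by (intro L2_sum L2_cmult L_in_L2)

lemma residual_L2:
  assumes "u \<in> L2 \<mu>"
  shows "residual u \<in> L2 \<mu>"
  using L2_add[OF assms L2_cmult[OF combination_L2, of "-1"]] by (simp add: residual_def)

lemma residual_orthogonal:
  assumes "u \<in> L2 \<mu>"
  shows "(\<integral>y. residual u y * L j y \<partial>\<mu>) = 0"
proof -
  have "(\<integral>y. residual u y * L j y \<partial>\<mu>)
      = (\<integral>y. u y * L j y - (\<Sum>k\<in>UNIV. projection u $ k * (L k y * L j y)) \<partial>\<mu>)"
    by (simp add: residual_def combination_def left_diff_distrib sum_distrib_right mult.assoc)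
  also have "\<dots> = L2_inner \<mu> u (L j) - (\<Sum>k\<in>UNIV. projection u $ k * L2_inner \<mu> (L k) (L j))"
    using L2_mult_integrable[OF assms L_in_L2[of j]] L2_mult_integrable[OF L_in_L2 L_in_L2[of j]]
    by (simp add: L2_inner_def Bochner_Integration.integral_diff Bochner_Integration.integral_sum
        Bochner_Integration.integrable_sum)
  also have "\<dots> = 0"
    by (simp add: inner_L projection_def if_distrib[of "\<lambda>t. _ * t"] cong: if_cong)
  finally show ?thesis .
qed

text \<open>Pythagoras: the residual is orthogonal to \<open>V\<close>.\<close>

lemma L2_norm_diff_combination:
  assumes u: "u \<in> L2 \<mu>"
  shows "(L2_norm \<mu> (\<lambda>y. u y - combination L c y))\<^sup>2
    = (L2_norm \<mu> (residual u))\<^sup>2 + (norm (c - projection u))\<^sup>2"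
proof -
  define d where "d = c - projection u"
  have "u y - combination L c y = residual u y - combination L d y" for y
    by (simp add: residual_def combination_def d_def left_diff_distrib sum_subtractf)
  moreover have "(residual u y - combination L d y)\<^sup>2
      = (residual u y)\<^sup>2 - 2 * (\<Sum>j\<in>UNIV. d $ j * (residual u y * L j y))
          + (\<Sum>j\<in>UNIV. \<Sum>k\<in>UNIV. d $ j * d $ k * (L j y * L k y))" for y
  proof -
    have "residual u y * combination L d y = (\<Sum>j\<in>UNIV. d $ j * (residual u y * L j y))"
      by (simp add: combination_def sum_distrib_left mult_ac)
    moreover have "(combination L d y)\<^sup>2 = (\<Sum>j\<in>UNIV. \<Sum>k\<in>UNIV. d $ j * d $ k * (L j y * L k y))"
      by (simp add: combination_def power2_eq_square sum_product mult_ac)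
    ultimately show ?thesis by (simp add: power2_diff mult.assoc)
  qed
  ultimately have "(L2_norm \<mu> (\<lambda>y. u y - combination L c y))\<^sup>2
      = (\<integral>y. (residual u y)\<^sup>2 - 2 * (\<Sum>j\<in>UNIV. d $ j * (residual u y * L j y))
          + (\<Sum>j\<in>UNIV. \<Sum>k\<in>UNIV. d $ j * d $ k * (L j y * L k y)) \<partial>\<mu>)"
    unfolding L2_norm_power2 by simp
  also have "\<dots> = (\<integral>y. (residual u y)\<^sup>2 \<partial>\<mu>)
      - 2 * (\<Sum>j\<in>UNIV. d $ j * (\<integral>y. residual u y * L j y \<partial>\<mu>))
      + (\<Sum>j\<in>UNIV. \<Sum>k\<in>UNIV. d $ j * d $ k * L2_inner \<mu> (L j) (L k))"
    using L2_mult_integrable[OF residual_L2[OF u] L_in_L2] L2_mult_integrable[OF L_in_L2 L_in_L2]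
      residual_L2[OF u]
    by (simp add: L2_inner_def L2_def Bochner_Integration.integral_diff Bochner_Integration.integral_add
        Bochner_Integration.integral_sum Bochner_Integration.integrable_sum)
  also have "\<dots> = (L2_norm \<mu> (residual u))\<^sup>2 + (norm d)\<^sup>2"
    unfolding power2_norm_eq_inner L2_norm_power2
    by (simp add: residual_orthogonal[OF u] inner_L inner_vec_def if_distrib[of "\<lambda>t. _ * t"] cong: if_cong)
  finally show ?thesis unfolding d_def .
qed

lemma V_combination:
  assumes "v \<in> V"
  obtains c where "v = combination L c"
  using assms span_L span_range_combination by metis

lemma L2_norm_residual_le_best_error:
  assumes "u \<in> L2 \<mu>"
  shows "(L2_norm \<mu> (residual u))\<^sup>2 \<le> (best_error \<mu> V u)\<^sup>2"
proof -
  have nonneg: "0 \<le> L2_norm \<mu> f" for f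
    by (simp add: L2_norm_def L2_inner_def)
  have "L2_norm \<mu> (residual u) \<le> best_error \<mu> V u"
    unfolding best_error_def
  proof (rule cINF_greatest)
    show "V \<noteq> {}" using L_in_V by blast
    fix v assume "v \<in> V"
    then obtain c where "v = combination L c" by (rule V_combination)
    then have "(L2_norm \<mu> (residual u))\<^sup>2 \<le> (L2_norm \<mu> (\<lambda>y. u y - v y))\<^sup>2"
      using L2_norm_diff_combination[OF assms, of c] by simp
    then show "L2_norm \<mu> (residual u) \<le> L2_norm \<mu> (\<lambda>y. u y - v y)"
      using nonneg by (rule power2_le_imp_le)
  qed
  then show ?thesis
    using nonneg by (rule power_mono)
qed

definition weighted_residual :: "('a \<Rightarrow> real) \<Rightarrow> 'a \<Rightarrow> real" where
  "weighted_residual u y = sqrt (w y) * residual u y"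

lemma weighted_residual:
  assumes u: "u \<in> L2 \<mu>"
  shows "weighted_residual u \<in> borel_measurable \<sigma>"
    and "integrable \<sigma> (\<lambda>y. (weighted_residual u y)\<^sup>2)"
    and "(\<integral>y. (weighted_residual u y)\<^sup>2 \<partial>\<sigma>) \<le> (L2_norm \<mu> (residual u))\<^sup>2"
    and "(\<integral>y. weighted_residual u y * feature y $ j \<partial>\<sigma>) = 0"
proof -
  have [measurable]: "residual u \<in> borel_measurable \<mu>"
    and sq: "integrable \<mu> (\<lambda>y. (residual u y)\<^sup>2)"
    using residual_L2[OF u] by (simp_all add: L2_def)
  have meas: "weighted_residual u \<in> borel_measurable \<mu>"
    unfolding weighted_residual_def[abs_def] by measurable
  note [measurable] = meas
  show "weighted_residual u \<in> borel_measurable \<sigma>" by measurable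
  have sq_eq: "\<rho> y * (weighted_residual u y)\<^sup>2 = (if \<rho> y = 0 then 0 else (residual u y)\<^sup>2)" for y
  proof -
    have "(weighted_residual u y)\<^sup>2 = w y * (residual u y)\<^sup>2"
      by (simp add: weighted_residual_def power_mult_distrib)
    then show ?thesis by (simp add: w_def)
  qed
  have bound: "\<rho> y * (weighted_residual u y)\<^sup>2 \<le> (residual u y)\<^sup>2" "0 \<le> \<rho> y * (weighted_residual u y)\<^sup>2" for y
    unfolding sq_eq by simp_all
  have int: "integrable \<mu> (\<lambda>y. \<rho> y * (weighted_residual u y)\<^sup>2)"
    using bound by (intro Bochner_Integration.integrable_bound[OF sq]) auto
  then show "integrable \<sigma> (\<lambda>y. (weighted_residual u y)\<^sup>2)"
    by (subst integral_\<sigma>) measurable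
  have "(\<integral>y. (weighted_residual u y)\<^sup>2 \<partial>\<sigma>) = (\<integral>y. \<rho> y * (weighted_residual u y)\<^sup>2 \<partial>\<mu>)"
    by (intro integral_\<sigma>) measurable
  also have "\<dots> \<le> (\<integral>y. (residual u y)\<^sup>2 \<partial>\<mu>)"
    using int sq bound by (intro integral_mono)
  finally show "(\<integral>y. (weighted_residual u y)\<^sup>2 \<partial>\<sigma>) \<le> (L2_norm \<mu> (residual u))\<^sup>2"
    by (simp add: L2_norm_power2)
  have "(\<integral>y. weighted_residual u y * feature y $ j \<partial>\<sigma>) = (\<integral>y. w y * residual u y * L j y \<partial>\<sigma>)"
    by (simp add: weighted_residual_def feature_def mult_ac)
  also have "\<dots> = (\<integral>y. \<rho> y * (w y * residual u y * L j y) \<partial>\<mu>)"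
    by (intro integral_\<sigma>) measurable
  also have "\<dots> = (\<integral>y. residual u y * L j y \<partial>\<mu>)"
  proof (intro Bochner_Integration.integral_cong refl)
    fix y assume "y \<in> space \<mu>"
    have "\<rho> y * (w y * residual u y * L j y) = residual u y * (\<rho> y * (w y * L j y))"
      by (simp add: mult_ac)
    then show "\<rho> y * (w y * residual u y * L j y) = residual u y * L j y"
      using density_weight_L[OF \<open>y \<in> space \<mu>\<close>] by simp
  qed
  finally show "(\<integral>y. weighted_residual u y * feature y $ j \<partial>\<sigma>) = 0"
    by (simp add: residual_orthogonal[OF u])
qed

text \<open>The normal equations in coordinates: the error of the coefficients is driven only by the part of \<open>u\<close>
  that is orthogonal to \<open>V\<close>, sampled through the same vectors that build the Gram matrix.\<close>

lemma gram_mult_coefficient_error: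
  assumes sol: "is_wls_solution V w m x u (combination L c)"
  shows "gram w m x L *v (c - projection u) = features.empirical_noise (weighted_residual u) m x"
proof -
  have "(gram w m x L *v (c - projection u)) $ j
      = features.empirical_noise (weighted_residual u) m x $ j" for j
  proof -
    have "(gram w m x L *v (c - projection u)) $ j
        = (\<Sum>k\<in>UNIV. \<Sum>i=1..m. w (x i) * L j (x i) * (L k (x i) * (c - projection u) $ k)) / real m"
      by (simp add: matrix_vector_mult_def gram_def weighted_inner_def sum_divide_distrib
          sum_distrib_left mult_ac)
    also have "(\<Sum>k\<in>UNIV. \<Sum>i=1..m. w (x i) * L j (x i) * (L k (x i) * (c - projection u) $ k))
        = (\<Sum>i=1..m. w (x i) * L j (x i) * (combination L c (x i) - combination L (projection u) (x i)))"
      by (subst sum.swap)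
        (simp add: combination_def sum_distrib_left left_diff_distrib right_diff_distrib sum_subtractf mult_ac)
    also have "\<dots> = (\<Sum>i=1..m. w (x i) * residual u (x i) * L j (x i))
        - (\<Sum>i=1..m. w (x i) * (u (x i) - combination L c (x i)) * L j (x i))"
      by (simp add: residual_def algebra_simps flip: sum_subtractf)
    also have "(\<Sum>i=1..m. w (x i) * (u (x i) - combination L c (x i)) * L j (x i)) = 0"
      by (rule wls_normal_equation[OF sol subspace_V L_in_V w_nonneg])
    also have "((\<Sum>i=1..m. w (x i) * residual u (x i) * L j (x i)) - 0) / real m
        = features.empirical_noise (weighted_residual u) m x $ j"
      by (simp add: features.empirical_noise_def weighted_residual_def feature_def divide_inverse mult_ac
         )
    finally show ?thesis .
  qed
  then show ?thesis by (simp add: vec_eq_iff)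
qed

text \<open>On the event that the Gram matrix is within \<open>1/2\<close> of the identity, the coefficient error is at most twice
  the empirical noise, whose second moment is at most \<open>R/m\<close> times the squared residual; this accounts for
  the summand \<open>4 R / m\<close>.\<close>

theorem wls_error_bound:
  fixes est :: "(nat \<Rightarrow> 'a) \<Rightarrow> 'a \<Rightarrow> real" and m :: nat
  defines "P \<equiv> \<Pi>\<^sub>M i\<in>{1..m}. \<sigma>"
    and "well_posed \<equiv> {x. spectral_norm (gram w m x L - mat 1) \<le> 1/2}"
  assumes u: "u \<in> L2 \<mu>" and "0 < m"
    and est: "\<And>x. x \<in> space P \<Longrightarrow> is_wls_solution V w m x u (est x)"
  shows "integrable P (\<lambda>x. (L2_norm \<mu> (\<lambda>y. u y - est x y))\<^sup>2 * indicator well_posed x)"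
    and "(\<integral>x. (L2_norm \<mu> (\<lambda>y. u y - est x y))\<^sup>2 * indicator well_posed x \<partial>P)
      \<le> (1 + 4 * R / real m) * (best_error \<mu> V u)\<^sup>2"
proof -
  interpret P: prob_space P
    unfolding P_def by (intro prob_space_PiM features.prob_space_axioms)
  let ?N = "(L2_norm \<mu> (residual u))\<^sup>2"
  let ?b = "features.empirical_noise (weighted_residual u) m"
  let ?err = "\<lambda>x. (L2_norm \<mu> (\<lambda>y. u y - est x y))\<^sup>2 * indicator well_posed x"
  note wr = weighted_residual[OF u]
  have [measurable]: "weighted_residual u \<in> borel_measurable \<sigma>" by (rule wr)
  have G_meas [measurable]: "(\<lambda>x. gram w m x L) \<in> borel_measurable P"
    unfolding gram_eq_empirical P_def by measurable
  have b_meas: "?b \<in> borel_measurable P"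
    unfolding features.empirical_noise_def[abs_def] P_def by measurable
  \<comment> \<open>a measurable version of the coefficient error on the event where the Gram matrix is invertible\<close>
  obtain d where d [measurable]: "d \<in> borel_measurable P"
    and d_solves: "\<And>x z. det (gram w m x L) \<noteq> 0 \<Longrightarrow> gram w m x L *v z = ?b x \<Longrightarrow> z = d x"
    using borel_measurable_linear_solve[OF G_meas b_meas] by blast
  have err_eq: "?err x = (?N + (norm (d x))\<^sup>2) * indicator well_posed x"
    and d_le: "x \<in> well_posed \<Longrightarrow> (norm (d x))\<^sup>2 \<le> 4 * (norm (?b x))\<^sup>2" if x: "x \<in> space P" for x
  proof -
    have "est x \<in> V"
      using est[OF x] by (simp add: is_wls_solution_def is_arg_min_def)
    then obtain c where c: "est x = combination L c" by (rule V_combination)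
    have solves: "gram w m x L *v (c - projection u) = ?b x"
      using est[OF x] unfolding c by (rule gram_mult_coefficient_error)
    have "c - projection u = d x" if "x \<in> well_posed"
    proof (rule d_solves[OF _ solves])
      have "norm v \<le> 2 * norm (gram w m x L *v v)" for v
        using that by (intro norm_le_of_spectral_norm_le_half) (simp add: well_posed_def)
      then have "\<And>v. gram w m x L *v v = 0 \<Longrightarrow> v = 0"
        by (metis mult_zero_right norm_le_zero_iff norm_zero)
      then show "det (gram w m x L) \<noteq> 0"
        by (simp add: invertible_det_nz[symmetric] invertible_left_inverse matrix_left_invertible_ker)
    qed
    then show "?err x = (?N + (norm (d x))\<^sup>2) * indicator well_posed x"
      using L2_norm_diff_combination[OF u, of c] by (auto simp: c indicator_def)
    assume st: "x \<in> well_posed"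
    then have "norm (d x) \<le> 2 * norm (?b x)"
      using norm_le_of_spectral_norm_le_half[of "gram w m x L" "c - projection u"]
        \<open>x \<in> well_posed \<Longrightarrow> c - projection u = d x\<close> solves by (simp add: well_posed_def)
    then show "(norm (d x))\<^sup>2 \<le> 4 * (norm (?b x))\<^sup>2"
      using power_mono[of "norm (d x)" "2 * norm (?b x)" 2] by (simp add: power_mult_distrib)
  qed
  have meas: "?err \<in> borel_measurable P"
  proof -
    have "(\<lambda>x. (?N + (norm (d x))\<^sup>2) * (if spectral_norm (gram w m x L - mat 1) \<le> 1/2 then 1 else 0))
        \<in> borel_measurable P"
      by measurable
    moreover have "?err x
        = (?N + (norm (d x))\<^sup>2) * (if spectral_norm (gram w m x L - mat 1) \<le> 1/2 then 1 else 0)"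
      if "x \<in> space P" for x
      using err_eq[OF that] by (simp add: well_posed_def indicator_def)
    ultimately show ?thesis
      by (subst measurable_cong)
  qed
  note noise = features.expectation_empirical_noise[OF wr(1,2,4) \<open>0 < m\<close>, folded P_def]
  have bound_int: "integrable P (\<lambda>x. ?N + 4 * (norm (?b x))\<^sup>2)"
    using noise(1) by simp
  have bound: "?err x \<le> ?N + 4 * (norm (?b x))\<^sup>2" if "x \<in> space P" for x
    using d_le[OF that] unfolding err_eq[OF that] by (auto simp: indicator_def)
  show int: "integrable P ?err"
    using bound by (intro Bochner_Integration.integrable_bound[OF bound_int meas] AE_I2) auto
  have "(\<integral>x. ?err x \<partial>P) \<le> (\<integral>x. ?N + 4 * (norm (?b x))\<^sup>2 \<partial>P)"
    using int bound_int bound by (rule integral_mono)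
  also have "\<dots> = ?N + 4 * (\<integral>x. (norm (?b x))\<^sup>2 \<partial>P)"
    using noise(1) by (simp add: P.prob_space)
  also have "\<dots> \<le> ?N + 4 * (R / real m * ?N)"
    using noise(2) mult_left_mono[OF wr(3), of "R / real m"] R_pos by simp
  also have "\<dots> = (1 + 4 * R / real m) * ?N"
    by (simp add: algebra_simps)
  also have "\<dots> \<le> (1 + 4 * R / real m) * (best_error \<mu> V u)\<^sup>2"
    using R_pos by (intro mult_left_mono L2_norm_residual_le_best_error u) simp
  finally show "(\<integral>x. ?err x \<partial>P) \<le> (1 + 4 * R / real m) * (best_error \<mu> V u)\<^sup>2" .
qed

lemma truncated_error_le:
  assumes u: "u \<in> L2 \<mu>" and s: "s \<in> L2 \<mu>" and "0 < \<tau>" and bounded: "AE y in \<mu>. \<bar>u y\<bar> \<le> \<tau>"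
  shows "(L2_norm \<mu> (\<lambda>y. u y - truncate \<tau> (s y)))\<^sup>2 \<le> (L2_norm \<mu> (\<lambda>y. u y - s y))\<^sup>2"
    and "(L2_norm \<mu> (\<lambda>y. u y - truncate \<tau> (s y)))\<^sup>2 \<le> 4 * \<tau>\<^sup>2"
proof -
  have [measurable]: "u \<in> borel_measurable \<mu>" "s \<in> borel_measurable \<mu>"
    using u s by (simp_all add: L2_def)
  have le: "AE y in \<mu>. (u y - truncate \<tau> (s y))\<^sup>2 \<le> 4 * \<tau>\<^sup>2"
    using bounded
  proof eventually_elim
    case (elim y)
    then have "\<bar>u y - truncate \<tau> (s y)\<bar> \<le> 2 * \<tau>"
      using abs_truncate_le[of \<tau> "s y"] \<open>0 < \<tau>\<close> by linarith
    then show ?case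
      using abs_le_square_iff[of "u y - truncate \<tau> (s y)" "2 * \<tau>"] by (simp add: power_mult_distrib)
  qed
  have int: "integrable \<mu> (\<lambda>y. (u y - truncate \<tau> (s y))\<^sup>2)"
    using le by (intro integrable_const_bound[of _ "4 * \<tau>\<^sup>2"]) simp_all
  have "(\<integral>y. (u y - truncate \<tau> (s y))\<^sup>2 \<partial>\<mu>) \<le> (\<integral>y. 4 * \<tau>\<^sup>2 \<partial>\<mu>)"
    by (intro integral_mono_AE int le) simp
  then show "(L2_norm \<mu> (\<lambda>y. u y - truncate \<tau> (s y)))\<^sup>2 \<le> 4 * \<tau>\<^sup>2"
    by (simp add: L2_norm_power2 prob_space)
  have "integrable \<mu> (\<lambda>y. (u y - s y)\<^sup>2)"
    using L2_add[OF u L2_cmult[OF s, of "-1"]] by (simp add: L2_def)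
  moreover have "AE y in \<mu>. (u y - truncate \<tau> (s y))\<^sup>2 \<le> (u y - s y)\<^sup>2"
    using bounded by eventually_elim (simp add: truncate_contracts flip: abs_le_square_iff)
  ultimately show "(L2_norm \<mu> (\<lambda>y. u y - truncate \<tau> (s y)))\<^sup>2 \<le> (L2_norm \<mu> (\<lambda>y. u y - s y))\<^sup>2"
    unfolding L2_norm_power2 using int by (intro integral_mono_AE)
qed

theorem truncated_wls_error_bound:
  fixes est :: "(nat \<Rightarrow> 'a) \<Rightarrow> 'a \<Rightarrow> real" and m :: nat
  defines "P \<equiv> \<Pi>\<^sub>M i\<in>{1..m}. \<sigma>"
  assumes u: "u \<in> L2 \<mu>" and "0 < m"
    and est: "\<And>x. x \<in> space P \<Longrightarrow> is_wls_solution V w m x u (est x)"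
    and "0 < \<tau>" and bounded: "AE y in \<mu>. \<bar>u y\<bar> \<le> \<tau>"
    and unstable: "measure P {x \<in> space P. 1/2 \<le> spectral_norm (gram w m x L - mat 1)} \<le> \<epsilon>"
    and meas: "(\<lambda>x. (L2_norm \<mu> (\<lambda>y. u y - truncate \<tau> (est x y)))\<^sup>2) \<in> borel_measurable P"
  shows "integrable P (\<lambda>x. (L2_norm \<mu> (\<lambda>y. u y - truncate \<tau> (est x y)))\<^sup>2)"
    and "(\<integral>x. (L2_norm \<mu> (\<lambda>y. u y - truncate \<tau> (est x y)))\<^sup>2 \<partial>P)
      \<le> (1 + 4 * R / real m) * (best_error \<mu> V u)\<^sup>2 + 4 * \<epsilon> * \<tau>\<^sup>2"
proof -
  interpret P: prob_space P
    unfolding P_def by (intro prob_space_PiM features.prob_space_axioms)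
  let ?err = "\<lambda>x. (L2_norm \<mu> (\<lambda>y. u y - truncate \<tau> (est x y)))\<^sup>2"
  let ?S = "{x. spectral_norm (gram w m x L - mat 1) \<le> 1/2}"
  let ?U = "{x \<in> space P. 1/2 \<le> spectral_norm (gram w m x L - mat 1)}"
  let ?stable_err = "\<lambda>x. (L2_norm \<mu> (\<lambda>y. u y - est x y))\<^sup>2 * indicator ?S x"
  have [measurable]: "(\<lambda>x. gram w m x L) \<in> borel_measurable P"
    unfolding gram_eq_empirical P_def by measurable
  have U [measurable]: "?U \<in> sets P" by measurable
  have est_L2: "est x \<in> L2 \<mu>" if "x \<in> space P" for x
    using est[OF that] V_L2 by (auto simp: is_wls_solution_def is_arg_min_def)
  note pointwise = truncated_error_le[OF u est_L2 \<open>0 < \<tau>\<close> bounded]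
  note stable = wls_error_bound[OF u \<open>0 < m\<close> est[unfolded P_def], folded P_def]
  show int: "integrable P ?err"
    using pointwise(2) by (intro P.integrable_const_bound[of _ "4 * \<tau>\<^sup>2"] AE_I2 meas) simp_all
  have le: "?err x \<le> ?stable_err x + 4 * \<tau>\<^sup>2 * indicator ?U x" if "x \<in> space P" for x
    using pointwise[OF that] that
    by (cases "x \<in> ?S") (auto simp: indicator_def add_increasing2)
  have U_int: "integrable P (\<lambda>x. 4 * \<tau>\<^sup>2 * indicator ?U x)"
    by (intro P.integrable_const_bound[of _ "4 * \<tau>\<^sup>2"] AE_I2) (auto simp: indicator_def)
  have "(\<integral>x. ?err x \<partial>P) \<le> (\<integral>x. ?stable_err x + 4 * \<tau>\<^sup>2 * indicator ?U x \<partial>P)"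
    using int stable(1) U_int le by (intro integral_mono Bochner_Integration.integrable_add)
  also have "\<dots> = (\<integral>x. ?stable_err x \<partial>P) + 4 * \<tau>\<^sup>2 * measure P ?U"
    using stable(1) U_int U by (subst Bochner_Integration.integral_add) simp_all
  also have "\<dots> \<le> (1 + 4 * R / real m) * (best_error \<mu> V u)\<^sup>2 + 4 * \<tau>\<^sup>2 * \<epsilon>"
    by (intro add_mono stable(2) mult_left_mono unstable) simp_all
  finally show "(\<integral>x. ?err x \<partial>P) \<le> (1 + 4 * R / real m) * (best_error \<mu> V u)\<^sup>2 + 4 * \<epsilon> * \<tau>\<^sup>2"
    by (simp add: mult_ac)
qed

end

section \<open>Sampling from a perturbed Christoffel function\<close>

text \<open>It remains to verify the hypotheses of \<open>christoffel_sampling\<close> for \<open>R = c n\<close>. Integrating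
  \<open>c1 k \<le> kt \<le> c2 k\<close> and \<open>\<integral> k = n\<close> shows that \<open>I = \<integral> kt\<close> lies between \<open>c1 n\<close> and \<open>c2 n\<close>;
  therefore \<open>k \<le> kt / c1 \<le> (c2 n / c1) kt / I = c n \<rho>\<close>.\<close>

theorem theorem3p1:
  fixes D :: "(real^'d) set"
    and \<mu> :: "(real^'d) measure"
    and V :: "(real^'d \<Rightarrow> real) set"
    and L Lt :: "'n::finite \<Rightarrow> real^'d \<Rightarrow> real"
    and k kt w :: "real^'d \<Rightarrow> real"
    and z :: "nat \<Rightarrow> real^'d"
    and P :: "(nat \<Rightarrow> real^'d) measure"
    and G :: "(nat \<Rightarrow> real^'d) \<Rightarrow> real^'n^'n"
    and M m n :: nat
    and c1 c2 c \<gamma> \<eta> \<epsilon> :: real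
  assumes "prob_space \<mu>" and "space \<mu> = D"
    and "n = CARD('n)"
    and "V \<subseteq> L2 \<mu>" and "fun_vs.subspace V" and "fun_vs.dim V = n"
    and "orthonormal_basis (L2_inner \<mu>) V L"
    and "k = inv_christoffel L"
    \<comment> \<open>offline stage: an arbitrary realization of the points \<open>z\<close>\<close>
    and "\<forall>i\<in>{1..M}. z i \<in> D"
    and "\<forall>v\<in>V. empirical_inner M z v v = 0 \<longrightarrow> v = 0"
    and "orthonormal_basis (empirical_inner M z) V Lt"
    and "kt = inv_christoffel Lt"
    \<comment> \<open>online stage\<close>
    and "P = (\<Pi>\<^sub>M i\<in>{1..m}. sampling_measure \<mu> n kt)"
    and "w = weight \<mu> n kt"
    and "\<And>x. G x = gram w m x L"
    and "0 < c1" and "c1 \<le> c2"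
    and "\<forall>x\<in>D. c1 * k x \<le> kt x \<and> kt x \<le> c2 * k x"
    and "c = c2 / c1"
    and "\<gamma> = inverse (3/2 * ln (3/2) - 1/2)"
    and "0 < \<epsilon>" and "\<epsilon> < 1"
    and "real m \<ge> c * \<gamma> * real n * ln (2 * real n / \<epsilon>)"
    and "\<eta> = 4 * c * (real n / real m)"
  shows "\<P>(x in P. spectral_norm (G x - mat 1) \<ge> 1/2) \<le> \<epsilon> \<and>
    (\<forall>u\<in>L2 \<mu>. \<forall>est :: (nat \<Rightarrow> real^'d) \<Rightarrow> real^'d \<Rightarrow> real.
       (\<forall>x\<in>space P. is_wls_solution V w m x u (est x)) \<longrightarrow>
         (let err = (\<lambda>x. (L2_norm \<mu> (\<lambda>y. u y - est x y))\<^sup>2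
                           * indicator {x. spectral_norm (G x - mat 1) \<le> 1/2} x)
          in integrable P err \<and> (\<integral>x. err x \<partial>P) \<le> (1 + \<eta>) * (best_error \<mu> V u)\<^sup>2) \<and>
         (\<forall>\<tau>>0. esssup \<mu> (\<lambda>y. ereal \<bar>u y\<bar>) \<le> ereal \<tau> \<longrightarrow>
            (let err = (\<lambda>x. (L2_norm \<mu> (\<lambda>y. u y - truncate \<tau> (est x y)))\<^sup>2)
             in err \<in> borel_measurable P \<longrightarrow>
                integrable P err \<and>
                (\<integral>x. err x \<partial>P) \<le> (1 + \<eta>) * (best_error \<mu> V u)\<^sup>2 + 4 * \<epsilon> * \<tau>\<^sup>2))) \<and>
    \<eta> \<le> 4 / (\<gamma> * ln (2 * real n / \<epsilon>))"
proof -
  interpret \<mu>: prob_space \<mu> by fact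
  have n: "0 < real n"
    using \<open>n = CARD('n)\<close> by simp
  have inner_L: "L2_inner \<mu> (L j) (L i) = (if j = i then 1 else 0)" for i j
    using \<open>orthonormal_basis (L2_inner \<mu>) V L\<close> by (simp add: orthonormal_basis_def)
  have L_L2: "L j \<in> L2 \<mu>" and Lt_L2: "Lt j \<in> L2 \<mu>" for j
    using \<open>orthonormal_basis (L2_inner \<mu>) V L\<close> \<open>orthonormal_basis (empirical_inner M z) V Lt\<close> \<open>V \<subseteq> L2 \<mu>\<close>
      fun_vs.span_superset[of "range L"] fun_vs.span_superset[of "range Lt"]
    unfolding orthonormal_basis_def by blast+
  have k_int: "integrable \<mu> k" and kt_int: "integrable \<mu> kt"
    using L_L2 Lt_L2 unfolding \<open>k = inv_christoffel L\<close> \<open>kt = inv_christoffel Lt\<close> inv_christoffel_def[abs_def]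
    by (auto simp: L2_def intro!: Bochner_Integration.integrable_sum)
  have int_k: "(\<integral>y. k y \<partial>\<mu>) = real n"
  proof -
    have "(\<integral>y. k y \<partial>\<mu>) = (\<Sum>j\<in>UNIV. L2_inner \<mu> (L j) (L j))"
      unfolding \<open>k = inv_christoffel L\<close> inv_christoffel_def L2_inner_def using L2_mult_integrable[OF L_L2 L_L2]
      by (simp add: power2_eq_square Bochner_Integration.integral_sum)
    then show ?thesis
      using \<open>n = CARD('n)\<close> by (simp add: inner_L)
  qed
  have kt_nonneg: "0 \<le> kt y" for y
    unfolding \<open>kt = inv_christoffel Lt\<close> inv_christoffel_def by (intro sum_nonneg) simp
  define I where "I = (\<integral>y. kt y \<partial>\<mu>)"
  have "c1 * real n \<le> I"
  proof -
    have "(\<integral>y. c1 * k y \<partial>\<mu>) \<le> I"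
      unfolding I_def using k_int kt_int assms by (intro integral_mono) simp_all
    then show ?thesis by (simp add: int_k)
  qed
  then have I_pos: "0 < I"
    using n \<open>0 < c1\<close> by (smt (verit) mult_pos_pos)
  have I_le: "I \<le> c2 * real n"
  proof -
    have "I \<le> (\<integral>y. c2 * k y \<partial>\<mu>)"
      unfolding I_def using k_int kt_int assms by (intro integral_mono) simp_all
    then show ?thesis by (simp add: int_k)
  qed
  have c_pos: "0 < c"
    using \<open>0 < c1\<close> \<open>c1 \<le> c2\<close> \<open>c = c2 / c1\<close> by simp
  define \<rho> where "\<rho> y = norm_factor \<mu> n kt * (kt y / real n)" for y
  have \<rho>: "\<rho> y = kt y / I" for y
    using n by (simp add: \<rho>_def norm_factor_def I_def)
  interpret C: christoffel_sampling \<mu> V L \<rho> "c * real n"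
  proof (intro christoffel_sampling.intro christoffel_sampling_axioms.intro)
    have kt_meas [measurable]: "kt \<in> borel_measurable \<mu>"
      using kt_int by (rule borel_measurable_integrable)
    show "\<rho> \<in> borel_measurable \<mu>"
      unfolding \<rho>_def[abs_def] by measurable
    show "0 \<le> \<rho> y" for y
      using kt_nonneg I_pos by (simp add: \<rho>)
    have "(\<integral>\<^sup>+y. ennreal (\<rho> y) \<partial>\<mu>) = ennreal (\<integral>y. \<rho> y \<partial>\<mu>)"
      unfolding \<rho> using kt_int kt_nonneg I_pos by (intro nn_integral_eq_integral) simp_all
    also have "(\<integral>y. \<rho> y \<partial>\<mu>) = 1"
      unfolding \<rho> using I_pos by (simp add: I_def)
    finally show "prob_space (density \<mu> (\<lambda>y. ennreal (\<rho> y)))"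
      using \<open>\<rho> \<in> borel_measurable \<mu>\<close>
      by (intro prob_spaceI) (simp add: emeasure_density cong: nn_integral_cong)
    show "0 < c * real n"
      using c_pos n by simp
    show "inv_christoffel L y \<le> c * real n * \<rho> y" if "y \<in> space \<mu>" for y
    proof -
      have k: "c1 * k y \<le> kt y"
        using assms that by simp
      have "k y \<le> kt y / c1"
        using k \<open>0 < c1\<close> by (simp add: field_simps)
      also have "\<dots> \<le> kt y / c1 * (c2 * real n / I)"
        using mult_left_mono[of 1 "c2 * real n / I" "kt y / c1"] I_le I_pos \<open>0 < c1\<close> kt_nonneg[of y] by simp
      also have "\<dots> = c * real n * \<rho> y"
        by (simp add: \<rho> \<open>c = c2 / c1\<close>)
      finally show ?thesis
        using \<open>k = inv_christoffel L\<close> by simp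
    qed
  qed (use assms in simp_all)
  have sampling: "sampling_measure \<mu> n kt = C.\<sigma>"
    by (simp add: sampling_measure_def C.\<sigma>_def \<rho>_def)
  have weight: "w = C.w"
    by (simp add: \<open>w = weight \<mu> n kt\<close> weight_def C.w_def \<rho>_def fun_eq_iff)
  have G: "G x = gram C.w m x L" for x
    using assms weight by simp
  have P: "P = (\<Pi>\<^sub>M i\<in>{1..m}. C.\<sigma>)"
    using assms sampling by simp
  have rate: "1 / \<gamma> = 3/2 * ln (3/2) - 1/2"
    using \<open>\<gamma> = inverse (3/2 * ln (3/2) - 1/2)\<close> by (simp add: inverse_eq_divide)
  have \<gamma>_pos: "0 < \<gamma>"
    using gamma_inverse_pos \<open>\<gamma> = inverse (3/2 * ln (3/2) - 1/2)\<close> by simp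
  have log_pos: "0 < ln (2 * real n / \<epsilon>)"
  proof -
    have "1 < 2 * real n / \<epsilon>"
    proof -
      have "1 \<le> real n" using n by simp
      then have "\<epsilon> < 2 * real n" using \<open>\<epsilon> < 1\<close> by linarith
      then show ?thesis using \<open>0 < \<epsilon>\<close> by simp
    qed
    then show ?thesis by simp
  qed
  have budget: "c * \<gamma> * real n * ln (2 * real n / \<epsilon>) \<le> real m"
    using assms by simp
  have m_pos: "0 < real m"
    using budget c_pos \<gamma>_pos n log_pos by (smt (verit) mult_pos_pos)
  then have m: "0 < m" by simp
  have deviation: "measure P {x \<in> space P. 1/2 \<le> spectral_norm (gram C.w m x L - mat 1)} \<le> \<epsilon>"
  proof -
    have "ln (2 * real n / \<epsilon>) \<le> real m / (c * real n) * (1 / \<gamma>)"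
      using budget c_pos \<gamma>_pos n by (simp add: field_simps)
    then have "exp (- (real m / (c * real n) * (1 / \<gamma>))) \<le> exp (- ln (2 * real n / \<epsilon>))"
      by simp
    also have "\<dots> = \<epsilon> / (2 * real n)"
      using n \<open>0 < \<epsilon>\<close> by (simp add: exp_minus)
    finally have "2 * real n * exp (- (real m / (c * real n) * (1 / \<gamma>))) \<le> \<epsilon>"
      using n by (simp add: field_simps)
    then show ?thesis
      using C.features.empirical_deviation[OF m] unfolding C.gram_eq_empirical P rate \<open>n = CARD('n)\<close>
      by (rule order_trans[rotated])
  qed
  have \<eta>: "4 * (c * real n) / real m = \<eta>"
    using \<open>\<eta> = 4 * c * (real n / real m)\<close> by simp
  have "\<eta> \<le> 4 / (\<gamma> * ln (2 * real n / \<epsilon>))"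
    unfolding \<eta>[symmetric] using budget m_pos \<gamma>_pos log_pos by (simp add: field_simps)
  moreover have "let err = (\<lambda>x. (L2_norm \<mu> (\<lambda>y. u y - est x y))\<^sup>2
        * indicator {x. spectral_norm (G x - mat 1) \<le> 1/2} x)
      in integrable P err \<and> (\<integral>x. err x \<partial>P) \<le> (1 + \<eta>) * (best_error \<mu> V u)\<^sup>2"
    if "u \<in> L2 \<mu>" "\<forall>x\<in>space P. is_wls_solution V w m x u (est x)" for u est
    using C.wls_error_bound[of u m est] that m unfolding P G weight \<eta> Let_def by simp
  moreover have "let err = (\<lambda>x. (L2_norm \<mu> (\<lambda>y. u y - truncate \<tau> (est x y)))\<^sup>2)
      in err \<in> borel_measurable P \<longrightarrow>
        integrable P err \<and> (\<integral>x. err x \<partial>P) \<le> (1 + \<eta>) * (best_error \<mu> V u)\<^sup>2 + 4 * \<epsilon> * \<tau>\<^sup>2"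
    if u: "u \<in> L2 \<mu>" and est: "\<forall>x\<in>space P. is_wls_solution V w m x u (est x)"
      and \<tau>: "0 < \<tau>" "esssup \<mu> (\<lambda>y. ereal \<bar>u y\<bar>) \<le> ereal \<tau>" for u est \<tau>
  proof -
    have bounded: "AE y in \<mu>. \<bar>u y\<bar> \<le> \<tau>"
      using esssup_AE[where M = \<mu> and f = "\<lambda>y. ereal \<bar>u y\<bar>"]
      by eventually_elim (use \<tau>(2) in \<open>metis ereal_less_eq(3) order_trans\<close>)
    have "is_wls_solution V C.w m x u (est x)" if "x \<in> space P" for x
      using est that weight by simp
    note bound = C.truncated_wls_error_bound[OF u m, folded P, OF this \<tau>(1) bounded deviation, unfolded \<eta>]
    show ?thesis
      unfolding Let_def by (intro impI conjI bound)
  qed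
  ultimately show ?thesis
    using deviation unfolding G by blast
qed

end
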